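(* Let $[\alpha,\beta]$ be a real interval with $0<\beta-\alpha<4$. Let $\{D_n\}_{n\geq 2}$ be defined by $D_2=1$ and $D_n=\frac{n^n(n-2)^{n-2}}{2^{2n-2}(2n-3)^{2n-3}}D_{n-1}$ for $n\geq 3$, and define for $n\geq 2$ $$a_n=(\beta-\alpha)^{n(n-1)}D_n,\qquad b_n=\frac{n^{2n}}{(n!)^2}.$$ Suppose there is an integer $n_0\geq 2$ with $$a_{n_0}<b_{n_0}\quad\text{and}\quad\frac{a_{n_0+1}}{a_{n_0}}<\frac{b_{n_0+1}}{b_{n_0}}.$$ If $\theta$ is an algebraic integer whose minimal polynomial $F_\theta(X)\in\mathbb{Z}[X]$ over $\mathbb{Q}$ has all of its roots in $[\alpha,\beta]$, then $[\mathbb{Q}(\theta):\mathbb{Q}]<n_0$.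
   Context: The quantity $a_n$ equals $d_n([\alpha,\beta])^{n(n-1)}$, where $d_n(E)=\sup_{x_1,\dots,x_n\in E}\prod_{i<j}|x_i-x_j|^{2/(n(n-1))}$ is the $n$-diameter. *)

theory Defs
  imports
    Complex_Main
    "HOL-Computational_Algebra.Polynomial"
    "HOL-Algebra.Generated_Fields"
    "HOL-Algebra.Finite_Extensions"
    "HOL-Algebra.Algebraic_Closure_Type"
begin

abbreviation complex_field :: "complex ring" where
  "complex_field \<equiv> ring_of_type_algebra"

text \<open>
  \<^term>\<open>\<rat> :: complex set\<close> is the subfield of rational numbers inside the complex numbers.
  Polynomials over it are coefficient lists, leading coefficient first;
  \<^const>\<open>ring.Irr\<close> is the monic irreducible one that vanishes at \<open>\<theta>\<close>.
\<close>

definition rat_minpoly :: "complex \<Rightarrow> complex list" where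
  "rat_minpoly \<theta> = ring.Irr complex_field \<rat> \<theta>"

definition rat_adjoin :: "complex \<Rightarrow> complex set" where
  "rat_adjoin \<theta> = generate_field complex_field (insert \<theta> \<rat>)"

definition rat_adjoin_degree :: "complex \<Rightarrow> nat" where
  "rat_adjoin_degree \<theta> = ring.dim complex_field \<rat> (rat_adjoin \<theta>)"

text \<open>The sequences below are meaningful for \<open>n \<ge> 2\<close> only.\<close>

fun D_seq :: "nat \<Rightarrow> real" where
  "D_seq n =
     (if n \<le> 2 then 1
      else real n ^ n * (real n - 2) ^ (n - 2)
             / (2 ^ (2 * n - 2) * (2 * real n - 3) ^ (2 * n - 3)) * D_seq (n - 1))"

declare D_seq.simps [simp del]

definition a_seq :: "real \<Rightarrow> real \<Rightarrow> nat \<Rightarrow> real" where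
  "a_seq \<alpha> \<beta> n = (\<beta> - \<alpha>) ^ (n * (n - 1)) * D_seq n"

definition b_seq :: "nat \<Rightarrow> real" where
  "b_seq n = real n ^ (2 * n) / (fact n)\<^sup>2"

end

theory Submission
  imports
    Defs
    "HOL-Analysis.Equivalence_Lebesgue_Henstock_Integration"
    "Jordan_Normal_Form.Determinant"
begin

text \<open>
  Let \<open>n\<close> be the degree of \<open>\<theta>\<close> and \<open>x\<^sub>1, \<dots>, x\<^sub>n\<close> its conjugates. The values of a nonzero
  integral polynomial of degree less than \<open>n\<close> at the \<open>x\<^sub>i\<close> have a nonzero integral product, so their
  absolute values sum to at least \<open>n\<close>; Minkowski's packing argument for the cross-polytope then gives
  \<open>b\<^sub>n \<le> \<Prod>(x\<^sub>i - x\<^sub>j)\<^sup>2\<close>.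

  The upper bound \<open>\<Prod>(x\<^sub>i - x\<^sub>j)\<^sup>2 \<le> a\<^sub>n\<close> needs no extremal polynomials: by Hadamard's inequality the
  left-hand side is at most the product of the squared norms of arbitrary monic polynomials of degrees
  \<open>0, \<dots>, n - 1\<close>, and monic polynomials adapted to the points can be built recursively so that the product
  factors into terms \<open>u\<^sup>k (1 - u)\<^sup>k\<^sup>-\<^sup>1\<close>, each of which is maximised separately. The parameters \<open>u\<close> are the
  canonical moments of even index of the counting measure on the points.

  The quotient of \<open>a\<^sub>n\<^sub>+\<^sub>1 / a\<^sub>n\<close> by \<open>b\<^sub>n\<^sub>+\<^sub>1 / b\<^sub>n\<close> is \<open>(\<beta> - \<alpha>)\<^sup>2\<^sup>n e\<^sub>n\<close> where the \<open>n\<close>-th root of \<open>e\<^sub>n\<close>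
  decreases, so once it is below 1 it stays there, and \<open>a\<^sub>n < b\<^sub>n\<close> for all \<open>n \<ge> n\<^sub>0\<close>.
\<close>

section \<open>Vandermonde determinants of points in an interval\<close>

definition monic_deg :: "nat \<Rightarrow> 'a::comm_ring_1 poly \<Rightarrow> bool" where
  "monic_deg k p \<longleftrightarrow> Polynomial.degree p \<le> k \<and> poly.coeff p k = 1"

lemma monic_deg_coeff_above: "monic_deg k p \<Longrightarrow> i > k \<Longrightarrow> poly.coeff p i = 0"
  by (auto simp: monic_deg_def coeff_eq_0)

lemma monic_degI:
  assumes "\<And>i. i > k \<Longrightarrow> poly.coeff p i = 0" "poly.coeff p k = 1"
  shows "monic_deg k p"
  using assms unfolding monic_deg_def by (auto intro: degree_le)

text \<open>Newton's interpolation basis. \<open>newton x k\<close> vanishes at the nodes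
  \<open>x j\<close> with \<open>j < k\<close>, so evaluating the basis at the nodes is triangular.
  Both the determinant below and the later volume computation rest on this.\<close>

definition newton :: "(nat \<Rightarrow> 'a::comm_ring_1) \<Rightarrow> nat \<Rightarrow> 'a poly" where
  "newton x k = (\<Prod>j<k. [:- x j, 1:])"

lemma newton_0 [simp]: "newton x 0 = 1"
  by (simp add: newton_def)

lemma newton_Suc: "newton x (Suc k) = pCons 0 (newton x k) - smult (x k) (newton x k)"
  by (simp add: newton_def algebra_simps)

lemma monic_deg_newton: "monic_deg k (newton x k)"
proof (induction k)
  case (Suc k)
  show ?case
    by (rule monic_degI)
      (use Suc monic_deg_coeff_above[OF Suc] in
        \<open>auto simp: newton_Suc coeff_pCons monic_deg_def split: nat.splits\<close>)
qed (simp add: monic_deg_def)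

lemma poly_newton: "poly (newton x k) y = (\<Prod>j<k. y - x j)"
  by (simp add: newton_def poly_prod algebra_simps)

lemma poly_newton_eq_0: "i < k \<Longrightarrow> poly (newton x k) (x i) = 0"
  for x :: "nat \<Rightarrow> 'a::idom"
  by (auto simp: poly_newton prod_zero_iff)

lemma newton_expansion:
  assumes "\<And>i. i \<ge> n \<Longrightarrow> poly.coeff p i = 0"
  shows "\<exists>c. p = (\<Sum>l<n. smult (c l) (newton x l))"
  using assms
proof (induction n arbitrary: p)
  case 0
  then have "p = 0" by (auto simp: poly_eq_iff)
  then show ?case by simp
next
  case (Suc n)
  define a where "a = poly.coeff p n"
  have "poly.coeff (p - smult a (newton x n)) i = 0" if "i \<ge> n" for i
    using that Suc.prems[of i] monic_deg_newton[of n x] monic_deg_coeff_above[OF monic_deg_newton, of n i x]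
    by (cases "i = n") (auto simp: a_def monic_deg_def)
  from Suc.IH[OF this] obtain c where c: "p - smult a (newton x n) = (\<Sum>l<n. smult (c l) (newton x l))"
    by blast
  have "p = (\<Sum>l<Suc n. smult ((c(n := a)) l) (newton x l))"
    using c by (simp add: algebra_simps)
  then show ?case by blast
qed

text \<open>Expanding each \<open>P k\<close> in the Newton basis factors the matrix as
  \<open>U * N\<close> with \<open>U\<close> lower unitriangular and \<open>N\<close> upper
  triangular, so only the diagonal of \<open>N\<close> contributes. The determinant is thus the same
  for every monic family.\<close>

lemma det_monic_deg:
  fixes x :: "nat \<Rightarrow> 'a::idom"
  assumes "\<And>k. k < n \<Longrightarrow> monic_deg k (P k)"
  shows "det (mat n n (\<lambda>(k, j). poly (P k) (x j))) = (\<Prod>j<n. \<Prod>i<j. x j - x i)"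
proof -
  have "\<exists>c. P k - newton x k = (\<Sum>l<k. smult (c l) (newton x l))" if "k < n" for k
  proof (rule newton_expansion)
    fix i assume "k \<le> i"
    then show "poly.coeff (P k - newton x k) i = 0"
      using assms[OF that] monic_deg_newton[of k x] 
        monic_deg_coeff_above[OF monic_deg_newton, of k i x] monic_deg_coeff_above[OF assms[OF that], of i]
      by (cases "i = k") (auto simp: monic_deg_def)
  qed
  then obtain c where c: "\<And>k. k < n \<Longrightarrow> P k - newton x k = (\<Sum>l<k. smult (c k l) (newton x l))"
    by metis
  define U where "U = mat n n (\<lambda>(k, l). if l < k then c k l else if l = k then 1 else 0)"
  define N where "N = mat n n (\<lambda>(l, j). poly (newton x l) (x j))"
  have "mat n n (\<lambda>(k, j). poly (P k) (x j)) = U * N"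
  proof (rule eq_matI)
    fix k j assume "k < dim_row (U * N)" "j < dim_col (U * N)"
    then have kj: "k < n" "j < n" by (auto simp: U_def N_def)
    have "(U * N) $$ (k, j) = (\<Sum>l = 0..<n. U $$ (k, l) * N $$ (l, j))"
      using kj by (simp add: U_def N_def scalar_prod_def)
    also have "\<dots> = (\<Sum>l\<in>insert k {..<k}. U $$ (k, l) * N $$ (l, j))"
      by (rule sum.mono_neutral_right) (use kj in \<open>auto simp: U_def\<close>)
    also have "\<dots> = poly (newton x k) (x j) + (\<Sum>l<k. c k l * poly (newton x l) (x j))"
      using kj by (simp add: U_def N_def)
    also have "\<dots> = poly (newton x k + (P k - newton x k)) (x j)"
      by (subst c[OF kj(1)]) (simp add: poly_sum)
    finally show "mat n n (\<lambda>(k, j). poly (P k) (x j)) $$ (k, j) = (U * N) $$ (k, j)"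
      using kj by simp
  qed (auto simp: U_def N_def)
  moreover have "det (U * N) = det U * det N"
    by (rule det_mult) (auto simp: U_def N_def)
  moreover have "det U = prod_list (diag_mat U)"
    by (rule det_lower_triangular[where n = n]) (auto simp: U_def)
  moreover have "prod_list (diag_mat U) = 1"
    unfolding diag_mat_def by (subst prod.distinct_set_conv_list[symmetric]) (auto simp: U_def)
  moreover have "det N = prod_list (diag_mat N)"
    by (rule det_upper_triangular[where n = n])
      (auto simp: N_def upper_triangular_def poly_newton_eq_0)
  moreover have "prod_list (diag_mat N) = (\<Prod>j<n. \<Prod>i<j. x j - x i)"
    unfolding diag_mat_def
    by (subst prod.distinct_set_conv_list[symmetric])
      (auto simp: N_def poly_newton atLeast0LessThan)
  ultimately show ?thesis by simp
qed

section \<open>Hadamard's inequality by Gram-Schmidt orthogonalisation\<close>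

text \<open>Gram-Schmidt for the bilinear form that sums over the points. Each step subtracts a
  projection onto polynomials of lower degree, which keeps the polynomial monic and cannot increase
  its norm.\<close>

lemma orthogonal_monic_exist:
  fixes x :: "nat \<Rightarrow> real" and P :: "nat \<Rightarrow> real poly"
  assumes "\<And>k. k < n \<Longrightarrow> monic_deg k (P k)"
  shows "\<exists>w. (\<forall>k<n. monic_deg k (w k)) \<and>
    (\<forall>k<n. \<forall>l<k. (\<Sum>j<m. poly (w k) (x j) * poly (w l) (x j)) = 0) \<and>
    (\<forall>k<n. (\<Sum>j<m. (poly (w k) (x j))\<^sup>2) \<le> (\<Sum>j<m. (poly (P k) (x j))\<^sup>2))"
  using assms
proof (induction n)
  case 0
  then show ?case by simp
next
  case (Suc n)
  define ip where "ip p q = (\<Sum>j<m. poly p (x j) * poly q (x j))" for p q :: "real poly"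
  have ip_diff: "ip (p - q) r = ip p r - ip q r"
    and ip_smult: "ip (smult c p) r = c * ip p r"
    and ip_add: "ip (p + q) r = ip p r + ip q r"
    and ip_commute: "ip p q = ip q p" for p q r c
    by (simp_all add: ip_def sum_subtractf sum.distrib sum_distrib_left algebra_simps)
  have ip_sum: "ip (\<Sum>l\<in>A. g l) r = (\<Sum>l\<in>A. ip (g l) r)" if "finite A" for A r and g :: "nat \<Rightarrow> real poly"
    using that by (induction A rule: finite_induct) (auto simp: ip_add, simp add: ip_def)
  have ip_self: "ip p p = (\<Sum>j<m. (poly p (x j))\<^sup>2)" for p
    by (simp add: ip_def power2_eq_square)
  \<comment> \<open>The form is only semidefinite, so some \<open>ip (w l) (w l)\<close> may be 0. A
    null vector is orthogonal to everything; hence the value 0 that division by 0 gives in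
    \<open>proj\<close> is a correct coefficient.\<close>
  have ip_null: "ip q p = 0" if "ip p p = 0" for p q
    using that unfolding ip_self by (simp add: sum_nonneg_eq_0_iff ip_def)
  obtain w where w: "\<And>k. k < n \<Longrightarrow> monic_deg k (w k)"
    and orth: "\<And>k l. k < n \<Longrightarrow> l < k \<Longrightarrow> ip (w k) (w l) = 0"
    and le: "\<And>k. k < n \<Longrightarrow> ip (w k) (w k) \<le> ip (P k) (P k)"
    using Suc.IH[OF Suc.prems] unfolding ip_self unfolding ip_def by auto
  define proj where "proj = (\<Sum>l<n. smult (ip (P n) (w l) / ip (w l) (w l)) (w l))"
  define v where "v = P n - proj"
  have orth': "ip (w l) (w k) = 0" if "k < n" "l < n" "l \<noteq> k" for k l
    using orth[of k l] orth[of l k] that by (metis ip_commute nat_neq_iff)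
  have "ip proj (w k) = ip (P n) (w k)" if "k < n" for k
  proof -
    have "ip proj (w k) = (\<Sum>l<n. ip (P n) (w l) / ip (w l) (w l) * ip (w l) (w k))"
      by (simp add: proj_def ip_sum ip_smult)
    also have "\<dots> = (\<Sum>l\<in>{k}. ip (P n) (w l) / ip (w l) (w l) * ip (w l) (w k))"
      by (rule sum.mono_neutral_right) (use that orth' in auto)
    also have "\<dots> = ip (P n) (w k)"
      using ip_null[of "w k" "P n"] by auto
    finally show ?thesis .
  qed
  then have v_orth: "ip v (w k) = 0" if "k < n" for k
    using that by (simp add: v_def ip_diff)
  have "ip (w k) v = 0" if "k < n" for k
    using v_orth[OF that] ip_commute by metis
  then have "ip proj v = 0"
    unfolding proj_def by (simp add: ip_sum ip_smult)
  then have "ip (P n) (P n) = ip v v + ip proj proj"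
    using ip_commute[of v proj] 
      ip_add[of v proj "v + proj"] ip_add[of v proj v] ip_add[of v proj proj]
      ip_commute[of v "v + proj"] ip_commute[of proj "v + proj"] by (simp add: v_def)
  moreover have "ip proj proj \<ge> 0"
    unfolding ip_self by (simp add: sum_nonneg)
  ultimately have v_le: "ip v v \<le> ip (P n) (P n)" by simp
  have "monic_deg n v"
  proof (rule monic_degI)
    have "poly.coeff proj i = 0" if "i \<ge> n" for i
      using that monic_deg_coeff_above[OF w] by (auto simp: proj_def coeff_sum)
    then show "poly.coeff v i = 0" if "i > n" for i
      using that monic_deg_coeff_above[OF Suc.prems[of n]] by (simp add: v_def)
    show "poly.coeff v n = 1"
      using \<open>\<And>i. i \<ge> n \<Longrightarrow> poly.coeff proj i = 0\<close>[of n] Suc.prems[of n] by (simp add: v_def monic_deg_def)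
  qed
  then have "(\<forall>k<Suc n. monic_deg k ((w(n := v)) k)) \<and>
      (\<forall>k<Suc n. \<forall>l<k. ip ((w(n := v)) k) ((w(n := v)) l) = 0) \<and>
      (\<forall>k<Suc n. ip ((w(n := v)) k) ((w(n := v)) k) \<le> ip (P k) (P k))"
    using w orth v_orth v_le le by (auto simp: less_Suc_eq)
  then show ?case unfolding ip_self unfolding ip_def by (rule exI[of _ "w(n := v)"])
qed

text \<open>The left-hand side is the Gram determinant of any monic family. For the orthogonalised
  family the Gram matrix is diagonal, and its norms do not exceed those of \<open>P\<close>.\<close>

theorem vandermonde_sq_le_prod_norms:
  fixes x :: "nat \<Rightarrow> real" and P :: "nat \<Rightarrow> real poly"
  assumes "\<And>k. k < n \<Longrightarrow> monic_deg k (P k)"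
  shows "(\<Prod>j<n. \<Prod>i<j. x j - x i)\<^sup>2 \<le> (\<Prod>k<n. \<Sum>j<n. (poly (P k) (x j))\<^sup>2)"
proof -
  obtain w where w: "\<And>k. k < n \<Longrightarrow> monic_deg k (w k)"
    and orth: "\<And>k l. k < n \<Longrightarrow> l < k \<Longrightarrow> (\<Sum>j<n. poly (w k) (x j) * poly (w l) (x j)) = 0"
    and le: "\<And>k. k < n \<Longrightarrow> (\<Sum>j<n. (poly (w k) (x j))\<^sup>2) \<le> (\<Sum>j<n. (poly (P k) (x j))\<^sup>2)"
    using orthogonal_monic_exist[where n = n and P = P and m = n and x = x, OF assms] by auto
  define A where "A = mat n n (\<lambda>(k, j). poly (w k) (x j))"
  define G where "G = A * transpose_mat A"
  have [simp]: "A \<in> carrier_mat n n" by (simp add: A_def)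
  have G: "G $$ (k, l) = (\<Sum>j<n. poly (w k) (x j) * poly (w l) (x j))" if "k < n" "l < n" for k l
    using that by (simp add: G_def A_def scalar_prod_def atLeast0LessThan)
  have [simp]: "G \<in> carrier_mat n n"
    unfolding G_def by (rule mult_carrier_mat[of _ n n]) simp_all
  have "(\<Prod>j<n. \<Prod>i<j. x j - x i)\<^sup>2 = (det A)\<^sup>2"
    using det_monic_deg[OF w, where x = x] by (simp add: A_def)
  also have "\<dots> = det G"
    unfolding G_def by (subst det_mult[where n = n]) (simp_all add: det_transpose[where n = n] power2_eq_square)
  also have "\<dots> = prod_list (diag_mat G)"
  proof (rule det_lower_triangular[where n = n])
    fix i j assume "i < j" "j < n"
    then show "G $$ (i, j) = 0"
      using orth[of j i] by (simp add: G mult.commute)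
  qed simp
  also have "\<dots> = (\<Prod>k<n. G $$ (k, k))"
    unfolding diag_mat_def
    by (subst prod.distinct_set_conv_list[symmetric]) (auto simp: atLeast0LessThan G_def A_def)
  also have "\<dots> = (\<Prod>k<n. \<Sum>j<n. (poly (w k) (x j))\<^sup>2)"
    by (auto simp: G power2_eq_square)
  also have "\<dots> \<le> (\<Prod>k<n. \<Sum>j<n. (poly (P k) (x j))\<^sup>2)"
    by (intro prod_mono) (auto simp: le sum_nonneg)
  finally show ?thesis .
qed

section \<open>Monic polynomials of small norm on the unit interval\<close>

text \<open>The squared norm of \<open>Q\<close> for the density t plus that of \<open>R\<close> for
  the density 1 - t, with respect to the counting measure on the points.\<close>

definition interval_form :: "(nat \<Rightarrow> real) \<Rightarrow> nat \<Rightarrow> real poly \<Rightarrow> real poly \<Rightarrow> real" where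
  "interval_form x n Q R = (\<Sum>j<n. x j * (poly Q (x j))\<^sup>2 + (1 - x j) * (poly R (x j))\<^sup>2)"

text \<open>
  With weights \<open>t = c\<^sup>2\<close> and \<open>1 - t = s\<^sup>2\<close>, both passages \<open>(Q, R) \<mapsto> (P, S)\<close> and \<open>(P, S) \<mapsto> (Q', R')\<close> in the
  proof are, up to scaling of the two components, rotations by the angle with cosine \<open>c\<close>; hence they
  transform the quadratic forms without cross terms.
\<close>

lemma interval_form_step:
  fixes x :: "nat \<Rightarrow> real"
  assumes x: "\<And>j. j < n \<Longrightarrow> x j \<in> {0..1}"
    and QR: "monic_deg k Q" "monic_deg k R"
  obtains P Q' R' u where "monic_deg (Suc k) P" "monic_deg (Suc k) Q'" "monic_deg (Suc k) R'"
    "0 \<le> u" "u \<le> 1"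
    "(\<Sum>j<n. (poly P (x j))\<^sup>2) = interval_form x n Q R / 4 * u"
    "interval_form x n Q' R' = interval_form x n Q R / 4 * (u * (1 - u))"
proof -
  define P where "P = smult (1/2) (pCons 0 Q - (R - pCons 0 R))"
  define S where "S = smult (1/2) (Q + R)"
  define h where "h = (\<Sum>j<n. (poly P (x j))\<^sup>2)"
  define g where "g = (\<Sum>j<n. x j * (1 - x j) * (poly S (x j))\<^sup>2)"
  \<comment> \<open>This \<open>u\<close> minimises \<open>(1 - u)^2 * h + u^2 * g\<close>, which is
    the form of the next pair. If \<open>h + g = 0\<close>, then \<open>h\<close> and
    \<open>g\<close> both vanish and \<open>u = 0\<close> by the convention for division, so
    \<open>hu\<close> and \<open>gu\<close> still hold.\<close>
  define u where "u = h / (h + g)"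
  define Q' where "Q' = smult (1 - u) P - smult u (S - pCons 0 S)"
  define R' where "R' = smult (1 - u) P + smult u (pCons 0 S)"
  have P: "monic_deg (Suc k) P"
    by (rule monic_degI)
      (use QR monic_deg_coeff_above[OF QR(1)] monic_deg_coeff_above[OF QR(2)] in
        \<open>auto simp: P_def coeff_pCons monic_deg_def split: nat.splits\<close>)
  have S: "monic_deg k S"
    by (rule monic_degI)
      (use QR monic_deg_coeff_above[OF QR(1)] monic_deg_coeff_above[OF QR(2)] in
        \<open>auto simp: S_def monic_deg_def\<close>)
  have Q': "monic_deg (Suc k) Q'"
    by (rule monic_degI)
      (use P S monic_deg_coeff_above[OF P] monic_deg_coeff_above[OF S] in
        \<open>auto simp: Q'_def coeff_pCons monic_deg_def split: nat.splits\<close>)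
  have R': "monic_deg (Suc k) R'"
    by (rule monic_degI)
      (use P S monic_deg_coeff_above[OF P] monic_deg_coeff_above[OF S] in
        \<open>auto simp: R'_def coeff_pCons monic_deg_def split: nat.splits\<close>)
  have id1: "((t * q - (r - t * r)) / 2)\<^sup>2 + t * (1 - t) * ((q + r) / 2)\<^sup>2 =
      (t * q\<^sup>2 + (1 - t) * r\<^sup>2) / 4" for t q r :: real
  proof -
    have "(t * q - (r - t * r))\<^sup>2 + t * (1 - t) * (q + r)\<^sup>2 = t * q\<^sup>2 + (1 - t) * r\<^sup>2"
      by (simp add: power2_eq_square algebra_simps)
    then show ?thesis
      by (simp add: power_divide add_divide_distrib[symmetric])
  qed
  have hg: "h + g = interval_form x n Q R / 4"
    unfolding h_def g_def interval_form_def sum.distrib[symmetric] sum_divide_distrib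
    by (rule sum.cong) (simp_all add: P_def S_def id1)
  have "h \<ge> 0" by (simp add: h_def sum_nonneg)
  have "g \<ge> 0" unfolding g_def by (intro sum_nonneg mult_nonneg_nonneg) (use x in auto)
  have u: "0 \<le> u" "u \<le> 1"
    using \<open>h \<ge> 0\<close> \<open>g \<ge> 0\<close> by (auto simp: u_def divide_simps)
  define t where "t = h + g"
  have hu: "h = t * u" and gu: "g = t * (1 - u)"
    using \<open>h \<ge> 0\<close> \<open>g \<ge> 0\<close> by (cases "h + g = 0"; simp add: t_def u_def right_diff_distrib)+
  have "interval_form x n Q' R' = (1 - u)\<^sup>2 * h + u\<^sup>2 * g"
    unfolding h_def g_def interval_form_def sum_distrib_left sum.distrib[symmetric]
    by (rule sum.cong) (auto simp: Q'_def R'_def power2_eq_square algebra_simps)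
  also have "\<dots> = t * (u * (1 - u))"
    unfolding hu gu by (simp add: power2_eq_square algebra_simps)
  finally have "interval_form x n Q' R' = interval_form x n Q R / 4 * (u * (1 - u))"
    by (simp add: t_def hg)
  moreover have "h = interval_form x n Q R / 4 * u"
    using hu by (simp add: t_def hg)
  ultimately show thesis
    using that[OF P Q' R' u] unfolding h_def by blast
qed

text \<open>For positive \<open>a\<close> and \<open>b\<close> the bound is the value at the
  maximiser a/(a+b). Bounding u(a+b)/a and (1-u)(a+b)/b by z \<le> exp(z-1) produces exponentials
  whose product is 1. With 0^0 = 1 the case of one zero exponent is covered too.\<close>

lemma weighted_amgm:
  fixes u :: real
  assumes "0 \<le> u" "u \<le> 1" "a + b > 0"
  shows "u ^ a * (1 - u) ^ b \<le> real a ^ a * real b ^ b / real (a + b) ^ (a + b)"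
proof -
  have *: "(z * real (a + b)) ^ c \<le> real c ^ c * exp (z * real (a + b) - real c)"
    if "z \<ge> 0" for z :: real and c :: nat
  proof (cases "c = 0")
    case False
    have "z * real (a + b) / real c \<le> exp (z * real (a + b) / real c - 1)"
      using exp_ge_add_one_self[of "z * real (a + b) / real c - 1"] by simp
    then have "(z * real (a + b) / real c) ^ c \<le> exp (z * real (a + b) / real c - 1) ^ c"
      using that by (intro power_mono) auto
    also have "\<dots> = exp (z * real (a + b) - real c)"
      using False by (simp flip: exp_of_nat_mult add: algebra_simps)
    finally show ?thesis
      using False by (simp add: power_divide divide_simps algebra_simps)
  qed (use that in auto)
  have "(u * real (a + b)) ^ a * ((1 - u) * real (a + b)) ^ b \<le>
      (real a ^ a * exp (u * real (a + b) - real a)) *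
      (real b ^ b * exp ((1 - u) * real (a + b) - real b))"
    by (intro mult_mono *) (use assms in auto)
  also have "\<dots> = real a ^ a * real b ^ b *
      (exp (u * real (a + b) - real a) * exp ((1 - u) * real (a + b) - real b))"
    by simp
  also have "exp (u * real (a + b) - real a) * exp ((1 - u) * real (a + b) - real b) = 1"
    by (simp add: algebra_simps flip: exp_add)
  finally have "u ^ a * (1 - u) ^ b * real (a + b) ^ (a + b) \<le> real a ^ a * real b ^ b"
    by (simp add: power_mult_distrib power_add mult_ac)
  moreover have "real (a + b) ^ (a + b) > 0"
    using assms by (intro zero_less_power) linarith
  ultimately show ?thesis
    by (simp only: pos_le_divide_eq)
qed

text \<open>The factor for \<open>k\<close> is the maximum of \<open>u^k * (1 - u)^(k - 1)\<close>
  over the unit interval, divided by \<open>4^k\<close>; for \<open>k = 1\<close> it is 1/4 because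
  0^0 = 1.\<close>

definition canonical_bound :: "nat \<Rightarrow> real" where
  "canonical_bound m = (\<Prod>k=1..m. real k ^ k * real (k - 1) ^ (k - 1) /
     (4 ^ k * real (2 * k - 1) ^ (2 * k - 1)))"

lemma canonical_bound_Suc:
  "canonical_bound (Suc m) = canonical_bound m *
    (real (Suc m) ^ Suc m * real m ^ m / (4 ^ Suc m * real (Suc m + m) ^ (Suc m + m)))"
proof -
  have *: "2 * Suc m - 1 = Suc m + m" "1 \<le> Suc m" by simp_all
  show ?thesis
    unfolding canonical_bound_def prod.nat_ivl_Suc'[OF *(2)] diff_Suc_1 *(1) by (rule mult.commute)
qed

lemma canonical_bound_nonneg: "canonical_bound m \<ge> 0"
  unfolding canonical_bound_def by (intro prod_nonneg) auto

lemma interval_form_nonneg: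
  assumes "\<And>j. j < n \<Longrightarrow> x j \<in> {0..1}"
  shows "interval_form x n Q R \<ge> 0"
  unfolding interval_form_def by (intro sum_nonneg) (use assms in auto)

text \<open>The parameter \<open>u\<close> of the first step enters its own norm once and each of
  the \<open>m\<close> later norms through the factor \<open>u * (1 - u)\<close> of the next form.
  Its exponents are therefore \<open>Suc m\<close> and \<open>m\<close>, and it can be maximised
  separately from the other parameters.\<close>

lemma exists_monic_small_norms:
  fixes x :: "nat \<Rightarrow> real"
  assumes x: "\<And>j. j < n \<Longrightarrow> x j \<in> {0..1}"
  assumes "monic_deg k Q" "monic_deg k R"
  shows "\<exists>P. (\<forall>i<m. monic_deg (Suc (k + i)) (P i)) \<and>
    (\<Prod>i<m. \<Sum>j<n. (poly (P i) (x j))\<^sup>2) \<le> interval_form x n Q R ^ m * canonical_bound m"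
  using assms(2,3)
proof (induction m arbitrary: k Q R)
  case 0
  then show ?case by (simp add: canonical_bound_def)
next
  case (Suc m)
  define W where "W = interval_form x n Q R"
  have "W \<ge> 0" unfolding W_def by (rule interval_form_nonneg[OF x])
  obtain P Q' R' u where mon: "monic_deg (Suc k) P" "monic_deg (Suc k) Q'" "monic_deg (Suc k) R'"
    and u: "0 \<le> u" "u \<le> 1"
    and h: "(\<Sum>j<n. (poly P (x j))\<^sup>2) = W / 4 * u"
    and W': "interval_form x n Q' R' = W / 4 * (u * (1 - u))"
    unfolding W_def by (rule interval_form_step[where n = n and x = x, OF x Suc.prems])
  obtain P' where P': "\<And>i. i < m \<Longrightarrow> monic_deg (Suc (Suc k + i)) (P' i)"
    and le: "(\<Prod>i<m. \<Sum>j<n. (poly (P' i) (x j))\<^sup>2) \<le> (W / 4 * (u * (1 - u))) ^ m * canonical_bound m"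
    using Suc.IH[OF mon(2,3)] unfolding W' by blast
  define P'' where "P'' i = (case i of 0 \<Rightarrow> P | Suc i \<Rightarrow> P' i)" for i
  have nonneg: "W ^ Suc m / 4 ^ Suc m * canonical_bound m \<ge> 0"
    using \<open>W \<ge> 0\<close> canonical_bound_nonneg[of m]
    by (intro mult_nonneg_nonneg divide_nonneg_nonneg) simp_all
  have "(\<Prod>i<Suc m. \<Sum>j<n. (poly (P'' i) (x j))\<^sup>2) =
      W / 4 * u * (\<Prod>i<m. \<Sum>j<n. (poly (P' i) (x j))\<^sup>2)"
    unfolding prod.lessThan_Suc_shift by (simp add: P''_def h)
  also have "\<dots> \<le> W / 4 * u * ((W / 4 * (u * (1 - u))) ^ m * canonical_bound m)"
    using le u \<open>W \<ge> 0\<close> by (intro mult_left_mono) auto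
  also have "\<dots> = W ^ Suc m / 4 ^ Suc m * canonical_bound m * (u ^ Suc m * (1 - u) ^ m)"
    by (simp add: power_mult_distrib power_divide)
  also have "\<dots> \<le> W ^ Suc m / 4 ^ Suc m * canonical_bound m *
      (real (Suc m) ^ Suc m * real m ^ m / real (Suc m + m) ^ (Suc m + m))"
    by (intro mult_left_mono weighted_amgm u nonneg) simp
  also have "\<dots> = W ^ Suc m * canonical_bound (Suc m)"
    by (simp add: canonical_bound_Suc del: power_Suc of_nat_Suc of_nat_add)
  finally have "(\<Prod>i<Suc m. \<Sum>j<n. (poly (P'' i) (x j))\<^sup>2) \<le> W ^ Suc m * canonical_bound (Suc m)" .
  moreover have "\<forall>i<Suc m. monic_deg (Suc (k + i)) (P'' i)"
    using mon(1) P' by (auto simp: P''_def split: nat.split)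
  ultimately show ?case unfolding W_def by blast
qed

text \<open>The constant 1 fills degree 0 with squared norm \<open>n\<close>, and the recursion
  starts at \<open>Q = R = 1\<close>, whose form is also \<open>n\<close>. Together these give the
  power \<open>n ^ n\<close>.\<close>

lemma vandermonde_sq_le_canonical_bound:
  fixes x :: "nat \<Rightarrow> real"
  assumes x: "\<And>j. j < n \<Longrightarrow> x j \<in> {0..1}" and "n \<ge> 1"
  shows "(\<Prod>j<n. \<Prod>i<j. x j - x i)\<^sup>2 \<le> real n ^ n * canonical_bound (n - 1)"
proof -
  obtain m where n: "n = Suc m" using \<open>n \<ge> 1\<close> by (cases n) auto
  have one: "monic_deg 0 (1 :: real poly)" by (simp add: monic_deg_def)
  obtain P where P: "\<And>i. i < m \<Longrightarrow> monic_deg (Suc i) (P i)"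
    and le: "(\<Prod>i<m. \<Sum>j<n. (poly (P i) (x j))\<^sup>2) \<le> interval_form x n 1 1 ^ m * canonical_bound m"
    using exists_monic_small_norms[where n = n and x = x and m = m, OF x one one] by auto
  define P' where "P' i = (case i of 0 \<Rightarrow> 1 | Suc i \<Rightarrow> P i)" for i
  have "monic_deg k (P' k)" if "k < n" for k
    using that P one by (auto simp: P'_def n split: nat.split)
  then have "(\<Prod>j<n. \<Prod>i<j. x j - x i)\<^sup>2 \<le> (\<Prod>k<n. \<Sum>j<n. (poly (P' k) (x j))\<^sup>2)"
    by (rule vandermonde_sq_le_prod_norms)
  also have "\<dots> = n * (\<Prod>i<m. \<Sum>j<n. (poly (P i) (x j))\<^sup>2)"
    by (subst (1) n, subst prod.lessThan_Suc_shift) (simp add: P'_def)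
  also have "\<dots> \<le> n * (interval_form x n 1 1 ^ m * canonical_bound m)"
    by (intro mult_left_mono le) auto
  also have "interval_form x n 1 1 = n" by (simp add: interval_form_def)
  finally show ?thesis by (simp add: n)
qed

section \<open>The recursion for \<open>D_seq\<close> and general intervals\<close>

lemma D_seq_2: "D_seq 2 = 1"
  using D_seq.simps[of 2] by simp

lemma D_seq_Suc:
  assumes "n \<ge> 2"
  shows "D_seq (Suc n) = real (Suc n) ^ Suc n * real (n - 1) ^ (n - 1) /
    (4 ^ n * real (2 * n - 1) ^ (2 * n - 1)) * D_seq n"
  using assms by (subst D_seq.simps) (auto simp: of_nat_diff power_mult power_even_eq)

lemma D_seq_eq_canonical_bound:
  assumes "n \<ge> 2"
  shows "D_seq n = real n ^ n * canonical_bound (n - 1)"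
  using assms
proof (induction n rule: dec_induct)
  case base
  then show ?case by (simp add: D_seq_2 canonical_bound_def)
next
  case (step n)
  obtain m where n: "n = Suc m" using step by (cases n) auto
  then show ?case
    using step by (simp add: D_seq_Suc canonical_bound_Suc n mult_2 del: power_Suc of_nat_Suc of_nat_add)
qed

text \<open>Rescaling affinely to the unit interval pulls out one factor \<beta> - \<alpha> for each
  of the n(n-1)/2 pairs, before squaring.\<close>

theorem vandermonde_sq_le_a_seq:
  fixes x :: "nat \<Rightarrow> real"
  assumes x: "\<And>j. j < n \<Longrightarrow> x j \<in> {\<alpha>..\<beta>}" and "n \<ge> 2" "\<alpha> < \<beta>"
  shows "(\<Prod>j<n. \<Prod>i<j. x j - x i)\<^sup>2 \<le> a_seq \<alpha> \<beta> n"
proof -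
  define L where "L = \<beta> - \<alpha>"
  have "L > 0" using assms by (simp add: L_def)
  define y where "y j = (x j - \<alpha>) / L" for j
  have diff: "x j - x i = L * (y j - y i)" for i j
    using \<open>L > 0\<close> by (simp add: y_def field_simps)
  have "(\<Prod>j<n. \<Prod>i<j. x j - x i) = (\<Prod>j<n. L ^ j) * (\<Prod>j<n. \<Prod>i<j. y j - y i)"
    unfolding diff by (simp add: prod.distrib)
  moreover have "(\<Prod>j<m. L ^ j)\<^sup>2 = L ^ (m * (m - 1))" for m
  proof (induction m)
    case (Suc m)
    then show ?case
      by (cases m) (auto simp: power_mult_distrib power2_eq_square power_add algebra_simps simp flip: power_mult)
  qed simp
  ultimately have "(\<Prod>j<n. \<Prod>i<j. x j - x i)\<^sup>2 = L ^ (n * (n - 1)) * (\<Prod>j<n. \<Prod>i<j. y j - y i)\<^sup>2"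
    by (simp add: power_mult_distrib)
  also have "\<dots> \<le> L ^ (n * (n - 1)) * (real n ^ n * canonical_bound (n - 1))"
    using \<open>L > 0\<close> assms
    by (intro mult_left_mono vandermonde_sq_le_canonical_bound)
      (auto simp: y_def L_def divide_simps)
  also have "\<dots> = a_seq \<alpha> \<beta> n"
    using assms by (simp add: a_seq_def L_def D_seq_eq_canonical_bound)
  finally show ?thesis .
qed

section \<open>Comparison of the sequences\<close>

text \<open>The e_n of the overview: the growth ratio of \<open>a_seq\<close> divided by that of
  \<open>b_seq\<close>, with the power of \<beta> - \<alpha> removed.\<close>

definition ratio_coeff :: "nat \<Rightarrow> real" where
  "ratio_coeff n = real (n - 1) ^ (n - 1) * real n ^ (2 * n) /
     (4 ^ n * real (2 * n - 1) ^ (2 * n - 1) * real (n + 1) ^ (n - 1))"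

lemma ratio_coeff_pos: "n \<ge> 2 \<Longrightarrow> ratio_coeff n > 0"
  unfolding ratio_coeff_def by (intro divide_pos_pos mult_pos_pos zero_less_power) auto

lemma D_seq_pos: "n \<ge> 2 \<Longrightarrow> D_seq n > 0"
proof (induction n rule: dec_induct)
  case base
  show ?case by (simp add: D_seq_2)
next
  case (step n)
  then show ?case
    unfolding D_seq_Suc[OF step(1)] by (intro mult_pos_pos divide_pos_pos zero_less_power) auto
qed

lemma b_seq_pos: "n \<ge> 2 \<Longrightarrow> b_seq n > 0"
  by (auto simp: b_seq_def)

lemma a_seq_Suc:
  assumes "n \<ge> 2"
  shows "a_seq \<alpha> \<beta> (Suc n) = a_seq \<alpha> \<beta> n * ((\<beta> - \<alpha>) ^ (2 * n) * (real (Suc n) ^ Suc n *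
    real (n - 1) ^ (n - 1) / (4 ^ n * real (2 * n - 1) ^ (2 * n - 1))))"
proof -
  have "Suc n * (Suc n - 1) = n * (n - 1) + 2 * n"
    by (cases n) (auto simp: algebra_simps)
  then have "(\<beta> - \<alpha>) ^ (Suc n * (Suc n - 1)) = (\<beta> - \<alpha>) ^ (n * (n - 1)) * (\<beta> - \<alpha>) ^ (2 * n)"
    by (simp only: power_add)
  then show ?thesis
    unfolding a_seq_def D_seq_Suc[OF assms] by (simp only: mult_ac)
qed

lemma b_seq_Suc:
  assumes "n \<ge> 2"
  shows "b_seq (Suc n) = b_seq n * (real (Suc n) ^ (2 * n) / real n ^ (2 * n))"
proof -
  define s where "s = real (Suc n)"
  have "s > 0" by (simp add: s_def)
  have "fact (Suc n) = s * fact n" by (simp add: s_def)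
  moreover have "s ^ (2 * Suc n) = s ^ (2 * n) * s\<^sup>2"
    by (simp add: power2_eq_square)
  ultimately have "b_seq (Suc n) = s ^ (2 * n) * s\<^sup>2 / (s * fact n)\<^sup>2"
    unfolding b_seq_def s_def by simp
  also have "\<dots> = s ^ (2 * n) / (fact n)\<^sup>2"
    using \<open>s > 0\<close> by (simp add: power_mult_distrib)
  also have "\<dots> = b_seq n * (s ^ (2 * n) / real n ^ (2 * n))"
    using assms by (simp add: b_seq_def)
  finally show ?thesis by (simp add: s_def)
qed

lemma ratio_less_iff:
  assumes "n \<ge> 2" "\<beta> - \<alpha> > 0"
  shows "a_seq \<alpha> \<beta> (Suc n) / a_seq \<alpha> \<beta> n < b_seq (Suc n) / b_seq n \<longleftrightarrow>
    (\<beta> - \<alpha>) ^ (2 * n) * ratio_coeff n < 1"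
proof -
  have [simp]: "a_seq \<alpha> \<beta> n \<noteq> 0" "b_seq n \<noteq> 0"
    using assms D_seq_pos[of n] b_seq_pos[of n] by (auto simp: a_seq_def)
  define s where "s = real (Suc n)"
  define A where "A = (\<beta> - \<alpha>) ^ (2 * n) * real (n - 1) ^ (n - 1) / (4 ^ n * real (2 * n - 1) ^ (2 * n - 1))"
  have "s > 0" by (simp add: s_def)
  \<comment> \<open>The growth ratio of \<open>a_seq\<close> contains \<open>s ^ Suc n\<close>;
    splitting the exponent lets it cancel against the ratio of \<open>b_seq\<close>.\<close>
  have "2 * n = Suc n + (n - 1)" using assms by simp
  then have s2n: "s ^ (2 * n) = s ^ Suc n * s ^ (n - 1)" by (simp only: power_add)
  have "a_seq \<alpha> \<beta> (Suc n) / a_seq \<alpha> \<beta> n < b_seq (Suc n) / b_seq n \<longleftrightarrow>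
      s ^ Suc n * A < s ^ (2 * n) / real n ^ (2 * n)"
    unfolding a_seq_Suc[OF assms(1)] b_seq_Suc[OF assms(1)] A_def s_def
    by (simp add: mult_ac del: of_nat_Suc power_Suc)
  also have "\<dots> \<longleftrightarrow> s ^ Suc n * (A * real n ^ (2 * n)) < s ^ Suc n * s ^ (n - 1)"
    using assms unfolding s2n by (simp add: pos_less_divide_eq mult_ac del: power_Suc)
  also have "\<dots> \<longleftrightarrow> A * real n ^ (2 * n) < s ^ (n - 1)"
    using \<open>s > 0\<close> by (subst mult_less_cancel_left_pos) auto
  also have "\<dots> \<longleftrightarrow> A * real n ^ (2 * n) / s ^ (n - 1) < 1"
    using \<open>s > 0\<close> by (subst divide_less_eq_1_pos) auto
  also have "A * real n ^ (2 * n) / s ^ (n - 1) = (\<beta> - \<alpha>) ^ (2 * n) * ratio_coeff n"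
    by (simp add: A_def ratio_coeff_def s_def add.commute)
  finally show ?thesis .
qed

section \<open>Log-concavity of the coefficients\<close>

text \<open>Interpolates the logarithm of \<open>ratio_coeff\<close> to real arguments, so that
  log-concavity follows from a second derivative.\<close>

definition log_ratio :: "real \<Rightarrow> real" where
  "log_ratio t = (t - 1) * ln (t - 1) + 2 * t * ln t - t * ln 4 - (2 * t - 1) * ln (2 * t - 1)
     - (t - 1) * ln (t + 1)"

lemma ln_ratio_coeff:
  assumes "n \<ge> 2"
  shows "ln (ratio_coeff n) = log_ratio (real n)"
proof -
  have "real n > 1" using assms by simp
  then show ?thesis
    using assms unfolding ratio_coeff_def log_ratio_def
    by (simp add: ln_div ln_mult ln_realpow of_nat_diff algebra_simps)
qed

text \<open>The second derivative of \<open>log_ratio\<close> is a negative multiple of t^2 (t - 3)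
  + (t - 1), which is visibly nonnegative from 3 onwards.\<close>

lemma convex_log_ratio: "convex_on {3..} (\<lambda>t. - log_ratio t)"
proof (rule f''_ge0_imp_convex)
  fix t :: real assume "t \<in> {3..}"
  then have t: "t \<ge> 3" by simp
  \<comment> \<open>All logarithms are brought to the shape \<open>ln (c * t - d)\<close>; this
    explains terms such as \<open>1 * t - 0\<close> and \<open>1 * t - (- 1)\<close> below.\<close>
  have lnd: "((\<lambda>t. ln (c * t - d)) has_real_derivative c / (c * t - d)) (at t)"
    if "c * t - d > 0" for c d
    using that by (auto intro!: derivative_eq_intros)
  have lin: "((\<lambda>t. c * t - d) has_real_derivative c) (at t)" for c d
    by (auto intro!: derivative_eq_intros)
  have xlnx: "((\<lambda>t. (c * t - d) * ln (c * t - d)) has_real_derivative c * ln (c * t - d) + c) (at t)"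
    if "c * t - d > 0" for c d
    using DERIV_mult[OF lin[of c d] lnd[OF that]] that by simp
  have "(t - 1) / (t + 1) = 1 - 2 / (t + 1)"
    using t by (simp add: field_simps)
  then have xln: "((\<lambda>t. (t - 1) * ln (t + 1)) has_real_derivative ln (t + 1) + (1 - 2 / (t + 1))) (at t)"
    using DERIV_mult[OF lin[of 1 1] lnd[of 1 "- 1"]] t by simp
  have "((\<lambda>t. - ((1 * t - 1) * ln (1 * t - 1) + 2 * ((1 * t - 0) * ln (1 * t - 0)) - t * ln 4
      - (2 * t - 1) * ln (2 * t - 1) - (t - 1) * ln (t + 1))) has_real_derivative
      - ((1 * ln (1 * t - 1) + 1) + 2 * (1 * ln (1 * t - 0) + 1) - ln 4 - (2 * ln (2 * t - 1) + 2)
        - (ln (t + 1) + (1 - 2 / (t + 1))))) (at t)"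
    by (intro DERIV_minus DERIV_diff DERIV_add DERIV_cmult xlnx xln)
      (use t in \<open>auto intro!: derivative_eq_intros\<close>)
  then show "((\<lambda>t. - log_ratio t) has_real_derivative
      - (ln (t - 1) + 2 * ln t - ln 4 - 2 * ln (2 * t - 1) - ln (t + 1) + 2 / (t + 1))) (at t)"
    unfolding log_ratio_def by (simp add: algebra_simps)
  have inv: "((\<lambda>t. 2 / (t + 1)) has_real_derivative - 2 / (t + 1)\<^sup>2) (at t)"
    using t by (auto intro!: derivative_eq_intros simp: power2_eq_square)
  have "((\<lambda>t. - (ln (1 * t - 1) + 2 * ln (1 * t - 0) - ln 4 - 2 * ln (2 * t - 1) - ln (1 * t - (- 1)) + 2 / (t + 1)))
      has_real_derivative
      - (1 / (1 * t - 1) + 2 * (1 / (1 * t - 0)) - 0 - 2 * (2 / (2 * t - 1)) - 1 / (1 * t - (- 1)) + - 2 / (t + 1)\<^sup>2)) (at t)"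
    by (intro DERIV_minus DERIV_diff DERIV_add DERIV_cmult DERIV_const lnd inv) (use t in auto)
  then show "((\<lambda>t. - (ln (t - 1) + 2 * ln t - ln 4 - 2 * ln (2 * t - 1) - ln (t + 1) + 2 / (t + 1)))
      has_real_derivative
      - (1 / (t - 1) + 2 / t - 4 / (2 * t - 1) - 1 / (t + 1) - 2 / (t + 1)\<^sup>2)) (at t)"
    by simp
  have "1 / (t - 1) + 2 / t - 4 / (2 * t - 1) - 1 / (t + 1) - 2 / (t + 1)\<^sup>2 =
      - 2 * (t\<^sup>2 * (t - 3) + (t - 1)) / (t * (2 * t - 1) * (t - 1) * (t + 1)\<^sup>2)"
  proof -
    have "1 / (t - 1) - 1 / (t + 1) - 2 / (t + 1)\<^sup>2 = 4 / ((t - 1) * (t + 1)\<^sup>2)"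
    proof -
      have "1 / (t - 1) - 1 / (t + 1) = 2 / ((t - 1) * (t + 1))"
        using t by (subst diff_frac_eq) auto
      also have "\<dots> - 2 / (t + 1)\<^sup>2 = 2 * ((t + 1) - (t - 1)) / ((t - 1) * (t + 1)\<^sup>2)"
      proof -
        have "2 / (a * b) - 2 / b\<^sup>2 = 2 * (b - a) / (a * b\<^sup>2)" if "a > 0" "b > 0" for a b :: real
          using that by (simp add: field_simps power2_eq_square)
        then show ?thesis using t by simp
      qed
      finally show ?thesis by simp
    qed
    moreover have "2 / t - 4 / (2 * t - 1) = - 2 / (t * (2 * t - 1))"
      using t by (simp add: divide_simps)
    moreover have "4 / ((t - 1) * (t + 1)\<^sup>2) + - 2 / (t * (2 * t - 1)) =
      - 2 * (t\<^sup>2 * (t - 3) + (t - 1)) / (t * (2 * t - 1) * ((t - 1) * (t + 1)\<^sup>2))"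
    proof -
      have "4 * (t * (2 * t - 1)) + - 2 * ((t - 1) * (t + 1)\<^sup>2) = - 2 * (t\<^sup>2 * (t - 3) + (t - 1))"
        by (simp add: power2_eq_square algebra_simps)
      then show ?thesis
        using t by (subst add_frac_eq) (auto simp: mult_ac)
    qed
    ultimately show ?thesis by (simp add: mult.assoc)
  qed
  moreover have "- 2 * (t\<^sup>2 * (t - 3) + (t - 1)) / (t * (2 * t - 1) * (t - 1) * (t + 1)\<^sup>2) \<le> 0"
    using t by (intro divide_nonpos_nonneg mult_nonpos_nonneg add_nonneg_nonneg mult_nonneg_nonneg) auto
  ultimately show "- (1 / (t - 1) + 2 / t - 4 / (2 * t - 1) - 1 / (t + 1) - 2 / (t + 1)\<^sup>2) \<ge> 0"
    by linarith
qed auto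

text \<open>The case \<open>n = 3\<close> is numerical because \<^const>\<open>log_ratio\<close> is not concave on all of \<open>[2, 4]\<close>.\<close>

lemma ratio_coeff_log_concave:
  assumes "n \<ge> 3"
  shows "ratio_coeff (n + 1) * ratio_coeff (n - 1) \<le> (ratio_coeff n)\<^sup>2"
proof (cases "n = 3")
  case True
  then show ?thesis by (simp add: ratio_coeff_def power2_eq_square)
next
  case False
  with assms have n: "n \<ge> 4" by simp
  have "- log_ratio (real n) \<le> (1 - 1/2) * - log_ratio (real (n - 1)) + 1/2 * - log_ratio (real (n + 1))"
    using convex_onD[OF convex_log_ratio, of "1/2" "real (n - 1)" "real (n + 1)"] n
    by (simp add: of_nat_diff field_simps)
  then have "ln (ratio_coeff (n + 1)) + ln (ratio_coeff (n - 1)) \<le> 2 * ln (ratio_coeff n)"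
    using n by (subst (1 2 3) ln_ratio_coeff) auto
  moreover have pos: "ratio_coeff n > 0" "ratio_coeff (n - 1) > 0" "ratio_coeff (n + 1) > 0"
    using n by (auto intro!: ratio_coeff_pos)
  ultimately have "ln (ratio_coeff (n + 1) * ratio_coeff (n - 1)) \<le> ln ((ratio_coeff n)\<^sup>2)"
    using ln_mult_pos[OF pos(3) pos(2)] ln_realpow[of "ratio_coeff n" 2] by simp
  then show ?thesis
    using pos by (subst (asm) ln_le_cancel_iff) auto
qed

text \<open>This says that the n-th root of e_n decreases. The case 2 is numerical; raising
  log-concavity to the power \<open>Suc n\<close> and inserting the induction hypothesis passes from
  \<open>n\<close> to \<open>Suc n\<close>.\<close>

lemma ratio_coeff_Suc_power_le:
  assumes "n \<ge> 2"
  shows "ratio_coeff (Suc n) ^ n \<le> ratio_coeff n ^ Suc n"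
  using assms
proof (induction n rule: dec_induct)
  case base
  show ?case by (simp add: ratio_coeff_def eval_nat_numeral)
next
  case (step n)
  define a b c where abc: "a = ratio_coeff n" "b = ratio_coeff (Suc n)" "c = ratio_coeff (Suc (Suc n))"
  have pos: "a > 0" "b > 0" "c > 0"
    using step ratio_coeff_pos by (auto simp: abc)
  have "c * a \<le> b\<^sup>2"
    using ratio_coeff_log_concave[of "Suc n"] step by (simp add: abc)
  then have "(c * a) ^ Suc n \<le> (b\<^sup>2) ^ Suc n"
    using pos by (intro power_mono) auto
  also have "\<dots> = b ^ Suc (Suc n) * b ^ n"
    by (simp add: power2_eq_square power_mult_distrib)
  also have "\<dots> \<le> b ^ Suc (Suc n) * a ^ Suc n"
    using step pos by (intro mult_left_mono) (auto simp: abc)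
  finally have "c ^ Suc n * a ^ Suc n \<le> b ^ Suc (Suc n) * a ^ Suc n"
    by (simp only: power_mult_distrib)
  then show ?case
    using pos by (simp add: abc)
qed

theorem a_seq_less_b_seq:
  assumes "\<beta> - \<alpha> > 0" "n0 \<ge> 2" "a_seq \<alpha> \<beta> n0 < b_seq n0"
    and "a_seq \<alpha> \<beta> (n0 + 1) / a_seq \<alpha> \<beta> n0 < b_seq (n0 + 1) / b_seq n0"
    and "n \<ge> n0"
  shows "a_seq \<alpha> \<beta> n < b_seq n"
proof -
  define L where "L = \<beta> - \<alpha>"
  have "L > 0" using assms by (simp add: L_def)
  have ratio: "L ^ (2 * n) * ratio_coeff n < 1" if "n \<ge> n0" for n
    using that
  proof (induction n rule: dec_induct)
    case base
    show ?case using assms ratio_less_iff[of n0 \<beta> \<alpha>] by (simp add: L_def)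
  next
    case (step n)
    have n: "n \<ge> 2" using step assms by simp
    have pos: "ratio_coeff n > 0" "ratio_coeff (Suc n) > 0"
      using n by (auto intro: ratio_coeff_pos)
    \<comment> \<open>Taking the n-th power makes the exponents of \<open>L\<close> agree with those
      in the (n+1)-st power of the previous quantity.\<close>
    have "(L ^ (2 * Suc n) * ratio_coeff (Suc n)) ^ n = (L ^ (2 * n)) ^ Suc n * ratio_coeff (Suc n) ^ n"
      by (simp only: power_mult_distrib power_mult[symmetric] mult_ac)
    also have "\<dots> \<le> (L ^ (2 * n)) ^ Suc n * ratio_coeff n ^ Suc n"
      using \<open>L > 0\<close> ratio_coeff_Suc_power_le[OF n] by (intro mult_left_mono) auto
    also have "\<dots> = (L ^ (2 * n) * ratio_coeff n) ^ Suc n"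
      by (simp only: power_mult_distrib)
    also have "\<dots> < 1"
      using step(3) \<open>L > 0\<close> pos by (subst power_less_one_iff) auto
    finally show ?case
      using n \<open>L > 0\<close> pos by (subst (asm) power_less_one_iff) auto
  qed
  show ?thesis
    using \<open>n \<ge> n0\<close>
  proof (induction n rule: dec_induct)
    case base
    show ?case using assms by simp
  next
    case (step n)
    have n: "n \<ge> 2" using step assms by simp
    have pos: "a_seq \<alpha> \<beta> n > 0" "b_seq n > 0"
      using assms n D_seq_pos[of n] b_seq_pos[of n] by (auto simp: a_seq_def)
    have "a_seq \<alpha> \<beta> (Suc n) / a_seq \<alpha> \<beta> n < b_seq (Suc n) / b_seq n"
      using ratio_less_iff[OF n assms(1)] ratio[OF step(1)] by (simp add: L_def)
    then have "a_seq \<alpha> \<beta> (Suc n) * b_seq n < b_seq (Suc n) * a_seq \<alpha> \<beta> n"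
      using pos by (simp add: divide_simps mult_ac)
    also have "\<dots> < b_seq (Suc n) * b_seq n"
      using step b_seq_pos[of "Suc n"] n by (intro mult_strict_left_mono) auto
    finally show ?case using pos by simp
  qed
qed

section \<open>A lower bound for discriminants\<close>

text \<open>Translation by \<open>t\<close> after a lower triangular linear map. The restriction to
  \<open>{..<n}\<close> keeps values extensional, as the points of the product space are. One map
  serves for both the volume scaling and translation invariance.\<close>

definition triangular_map :: "(nat \<Rightarrow> nat \<Rightarrow> real) \<Rightarrow> (nat \<Rightarrow> real) \<Rightarrow> nat \<Rightarrow> (nat \<Rightarrow> real) \<Rightarrow> nat \<Rightarrow> real" where
  "triangular_map a t n d = (\<lambda>i\<in>{..<n}. t i + (\<Sum>k\<le>i. a i k * d k))"

abbreviation lborel_pow :: "nat \<Rightarrow> (nat \<Rightarrow> real) measure" where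
  "lborel_pow n \<equiv> Pi\<^sub>M {..<n} (\<lambda>_. lborel)"

lemma measurable_triangular_map [measurable]:
  "triangular_map a t n \<in> lborel_pow n \<rightarrow>\<^sub>M lborel_pow n"
  unfolding triangular_map_def
proof (intro measurable_restrict)
  fix i assume i: "i \<in> {..<n}"
  have "(\<lambda>d. a i k * d k) \<in> borel_measurable (lborel_pow n)" if "k \<in> {..i}" for k
    using that i by (intro borel_measurable_times borel_measurable_const) (auto intro!: measurable_component_singleton)
  then show "(\<lambda>d. t i + (\<Sum>k\<le>i. a i k * d k)) \<in> lborel_pow n \<rightarrow>\<^sub>M lborel"
    by simp
qed

lemma measurable_fun_upd_lborel_pow:
  assumes "w \<in> space (lborel_pow n)"
  shows "(\<lambda>z. w(n := z)) \<in> borel \<rightarrow>\<^sub>M lborel_pow (Suc n)"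
proof -
  have "(\<lambda>z. w(n := z)) \<in> lborel \<rightarrow>\<^sub>M Pi\<^sub>M (insert n {..<n}) (\<lambda>_. lborel)"
    by (rule measurable_fun_upd[where J = "{..<n}"]) (use assms in auto)
  then show ?thesis by (simp add: lessThan_Suc)
qed

text \<open>Integrate over the last coordinate first: with the others fixed, it undergoes a
  one-dimensional affine substitution with slope \<open>a n n\<close>.\<close>

lemma nn_integral_triangular_map:
  assumes "f \<in> borel_measurable (lborel_pow n)" "\<And>i. i < n \<Longrightarrow> a i i \<noteq> 0"
  shows "ennreal (\<Prod>i<n. \<bar>a i i\<bar>) * (\<integral>\<^sup>+ d. f (triangular_map a t n d) \<partial>lborel_pow n) = integral\<^sup>N (lborel_pow n) f"
  using assms
proof (induction n arbitrary: f)
  case 0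
  show ?case
    by (simp add: triangular_map_def PiM_empty nn_integral_count_space_finite)
next
  case (Suc n)
  interpret product_sigma_finite "\<lambda>_ :: nat. lborel :: real measure" by standard
  note [measurable] = Suc.prems(1)
  have [measurable]: "f \<in> borel_measurable (Pi\<^sub>M (insert n {..<n}) (\<lambda>_. lborel))"
    using Suc.prems(1) by (simp add: lessThan_Suc)
  define G where "G w = (\<integral>\<^sup>+ z. f (w(n := z)) \<partial>lborel)" for w
  have split: "integral\<^sup>N (lborel_pow (Suc n)) g = (\<integral>\<^sup>+ w. \<integral>\<^sup>+ z. g (w(n := z)) \<partial>lborel \<partial>lborel_pow n)"
    if "g \<in> borel_measurable (lborel_pow (Suc n))" for g
    using product_nn_integral_insert[of "{..<n}" n g] that by (simp add: lessThan_Suc)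
  have [measurable]: "G \<in> borel_measurable (lborel_pow n)"
    unfolding G_def by measurable
  have inner: "ennreal \<bar>a n n\<bar> * (\<integral>\<^sup>+ z. f (triangular_map a t (Suc n) (w(n := z))) \<partial>lborel) = G (triangular_map a t n w)"
    if "w \<in> space (lborel_pow n)" for w
  proof -
    define s where "s = t n + (\<Sum>k<n. a n k * w k)"
    \<comment> \<open>The last coordinate \<open>z\<close> enters only the last component, by
      triangularity.\<close>
    have upd: "triangular_map a t (Suc n) (w(n := z)) = (triangular_map a t n w)(n := s + a n n * z)" for z
      by (auto simp: triangular_map_def fun_eq_iff s_def restrict_def lessThan_Suc_atMost[symmetric])
    have "triangular_map a t n w \<in> space (lborel_pow n)"
      using measurable_space[OF measurable_triangular_map that] .
    then have [measurable]: "(\<lambda>z. f ((triangular_map a t n w)(n := z))) \<in> borel_measurable borel"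
      by (rule measurable_compose[OF measurable_fun_upd_lborel_pow Suc.prems(1)])
    show ?thesis
      unfolding upd G_def
      by (rule nn_integral_real_affine[symmetric]) (use Suc.prems(2)[of n] in auto)
  qed
  have "ennreal (\<Prod>i<Suc n. \<bar>a i i\<bar>) * (\<integral>\<^sup>+ d. f (triangular_map a t (Suc n) d) \<partial>lborel_pow (Suc n)) =
    ennreal (\<Prod>i<n. \<bar>a i i\<bar>) * (ennreal \<bar>a n n\<bar> * (\<integral>\<^sup>+ w. \<integral>\<^sup>+ z. f (triangular_map a t (Suc n) (w(n := z))) \<partial>lborel \<partial>lborel_pow n))"
    by (subst split) (auto simp: ennreal_mult prod_nonneg mult_ac)
  also have "ennreal \<bar>a n n\<bar> * (\<integral>\<^sup>+ w. \<integral>\<^sup>+ z. f (triangular_map a t (Suc n) (w(n := z))) \<partial>lborel \<partial>lborel_pow n) =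
      (\<integral>\<^sup>+ w. ennreal \<bar>a n n\<bar> * (\<integral>\<^sup>+ z. f (triangular_map a t (Suc n) (w(n := z))) \<partial>lborel) \<partial>lborel_pow n)"
  proof (rule nn_integral_cmult[symmetric])
    have "(\<lambda>d. f (triangular_map a t (Suc n) d)) \<in> borel_measurable (Pi\<^sub>M (insert n {..<n}) (\<lambda>_. lborel))"
      unfolding lessThan_Suc[symmetric] by measurable
    then show "(\<lambda>w. \<integral>\<^sup>+ z. f (triangular_map a t (Suc n) (w(n := z))) \<partial>lborel) \<in> borel_measurable (lborel_pow n)"
      by measurable
  qed
  also have "\<dots> = (\<integral>\<^sup>+ w. G (triangular_map a t n w) \<partial>lborel_pow n)"
    by (intro nn_integral_cong inner)
  also have "ennreal (\<Prod>i<n. \<bar>a i i\<bar>) * \<dots> = integral\<^sup>N (lborel_pow n) G"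
    by (rule Suc.IH) (use Suc.prems in auto)
  also have "\<dots> = integral\<^sup>N (lborel_pow (Suc n)) f"
    unfolding G_def by (rule split[symmetric]) measurable
  finally show ?case .
qed

lemma emeasure_triangular_map:
  assumes "A \<in> sets (lborel_pow n)" "\<And>i. i < n \<Longrightarrow> a i i \<noteq> 0"
  shows "ennreal (\<Prod>i<n. \<bar>a i i\<bar>) *
    emeasure (lborel_pow n) {d \<in> space (lborel_pow n). triangular_map a t n d \<in> A} = emeasure (lborel_pow n) A"
proof -
  have "{d \<in> space (lborel_pow n). triangular_map a t n d \<in> A} \<in> sets (lborel_pow n)"
    using assms(1) by measurable
  then have "emeasure (lborel_pow n) {d \<in> space (lborel_pow n). triangular_map a t n d \<in> A} =
      (\<integral>\<^sup>+ d. indicator A (triangular_map a t n d) \<partial>lborel_pow n)"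
    by (subst nn_integral_indicator[symmetric], assumption, intro nn_integral_cong)
      (auto simp: indicator_def)
  then show ?thesis
    using nn_integral_triangular_map[of "indicator A" n a t] assms by simp
qed

lemma emeasure_translate:
  assumes "A \<in> sets (lborel_pow n)"
  shows "emeasure (lborel_pow n) {d \<in> space (lborel_pow n). (\<lambda>i\<in>{..<n}. t i + d i) \<in> A} = emeasure (lborel_pow n) A"
proof -
  have "triangular_map (\<lambda>i k. if i = k then 1 else 0) t n d = (\<lambda>i\<in>{..<n}. t i + d i)" for d
  proof -
    have "(\<Sum>k\<le>i. (if i = k then 1 else 0) * d k) = (\<Sum>k\<le>i. if i = k then d k else 0)" for i
      by (intro sum.cong) auto
    then show ?thesis by (simp add: triangular_map_def)
  qed
  then show ?thesis
    using emeasure_triangular_map[OF assms, of "\<lambda>i k. if i = k then 1 else 0" t] by simp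
qed

section \<open>The volume of the cross-polytope\<close>

definition cross_polytope :: "nat \<Rightarrow> real \<Rightarrow> (nat \<Rightarrow> real) set" where
  "cross_polytope n r = {y \<in> space (lborel_pow n). (\<Sum>i<n. \<bar>y i\<bar>) \<le> r}"

lemma sets_cross_polytope [measurable]: "cross_polytope n r \<in> sets (lborel_pow n)"
  unfolding cross_polytope_def by measurable

text \<open>The integrand is \<open>fact n\<close> times the volume of the slice at height
  \<open>y\<close> of a cross-polytope of radius \<open>r\<close>. The absolute value is handled by
  reflecting the negative half onto the positive one.\<close>

lemma nn_integral_tent:
  fixes r :: real
  assumes "r \<ge> 0"
  shows "(\<integral>\<^sup>+ y. ennreal ((2 * (r - \<bar>y\<bar>)) ^ n) * indicator {-r..r} y \<partial>lborel) = ennreal ((2 * r) ^ Suc n / real (Suc n))"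
proof -
  define c where "c = (2 * r) ^ Suc n / real (Suc n)"
  have "c \<ge> 0" using assms by (simp add: c_def)
  define g where "g y = ennreal ((2 * (r - \<bar>y\<bar>)) ^ n)" for y
  have 1: "(\<integral>\<^sup>+ y. g y * indicator {0..r} y \<partial>lborel) = ennreal (c / 2)"
  proof -
    have "(\<integral>\<^sup>+ y. g y * indicator {0..r} y \<partial>lborel) =
        (\<integral>\<^sup>+ y. ennreal ((2 * (r - y)) ^ n) * indicator {0..r} y \<partial>lborel)"
      by (intro nn_integral_cong) (auto simp: g_def indicator_def)
    also have "\<dots> = ennreal (- ((2 * (r - r)) ^ Suc n / real (Suc n) / 2) - - ((2 * (r - 0)) ^ Suc n / real (Suc n) / 2))"
    proof (rule nn_integral_FTC_Icc)
      fix y :: real assume "y \<in> {0..r}"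
      show "((\<lambda>y. - ((2 * (r - y)) ^ Suc n / real (Suc n) / 2)) has_real_derivative (2 * (r - y)) ^ n) (at y)"
        by (rule derivative_eq_intros refl | simp)+
    qed (use assms in auto)
    finally show ?thesis by (simp add: c_def)
  qed
  have 2: "(\<integral>\<^sup>+ y. g y * indicator {-r..0} y \<partial>lborel) = ennreal (c / 2)"
  proof -
    have "(\<integral>\<^sup>+ y. g y * indicator {-r..0} y \<partial>lborel) = \<bar>- 1 :: real\<bar> * (\<integral>\<^sup>+ y. g (0 + (- 1) * y) * indicator {-r..0} (0 + (- 1) * y) \<partial>lborel)"
      by (rule nn_integral_real_affine) (auto simp: g_def)
    also have "\<dots> = (\<integral>\<^sup>+ y. g y * indicator {0..r} y \<partial>lborel)"
      by (simp, intro nn_integral_cong) (auto simp: g_def indicator_def)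
    finally show ?thesis by (simp add: 1)
  qed
  have "(\<integral>\<^sup>+ y. g y * indicator {-r..r} y \<partial>lborel) =
      (\<integral>\<^sup>+ y. g y * indicator {-r..0} y + g y * indicator {0..r} y \<partial>lborel)"
  \<comment> \<open>Both halves contain 0, so the integrands agree only off that null set.\<close>
  proof (rule nn_integral_cong_AE)
    have "AE y in lborel. y \<noteq> (0 :: real)" by (rule AE_lborel_singleton)
    then show "AE y in lborel. g y * indicator {-r..r} y = g y * indicator {-r..0} y + g y * indicator {0..r} y"
      by eventually_elim (use assms in \<open>auto simp: indicator_def\<close>)
  qed
  also have "\<dots> = ennreal (c / 2) + ennreal (c / 2)"
    by (subst nn_integral_add) (auto simp: 1 2, auto simp: g_def)
  also have "\<dots> = ennreal c"
    using \<open>c \<ge> 0\<close> by (subst ennreal_plus[symmetric]) auto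
  finally show ?thesis by (simp add: g_def c_def)
qed

text \<open>Fixing the last coordinate at \<open>y\<close> leaves a cross-polytope of radius
  \<open>r - \<bar>y\<bar>\<close>, so the induction runs over all radii; the indicator discards
  heights where this radius is negative.\<close>

lemma emeasure_cross_polytope:
  assumes "r \<ge> 0"
  shows "emeasure (lborel_pow n) (cross_polytope n r) = ennreal ((2 * r) ^ n / fact n)"
  using assms
proof (induction n arbitrary: r)
  case 0
  then show ?case by (simp add: cross_polytope_def PiM_empty)
next
  case (Suc n)
  interpret product_sigma_finite "\<lambda>_ :: nat. lborel :: real measure" by standard
  have *: "indicator (cross_polytope (Suc n) r) (x(n := y)) =
      (indicator {-r..r} y * indicator (cross_polytope n (r - \<bar>y\<bar>)) x :: ennreal)"
    if "x \<in> space (lborel_pow n)" for x y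
  proof -
    define s where "s = (\<Sum>i<n. \<bar>x i\<bar>)"
    have "(\<Sum>i<n. \<bar>(x(n := y)) i\<bar>) = s" unfolding s_def by (intro sum.cong) auto
    then have "x(n := y) \<in> cross_polytope (Suc n) r \<longleftrightarrow> \<bar>y\<bar> + s \<le> r"
      using that by (auto simp: cross_polytope_def space_PiM lessThan_Suc PiE_def extensional_def)
    moreover have "x \<in> cross_polytope n t \<longleftrightarrow> s \<le> t" for t
      using that by (simp add: cross_polytope_def s_def)
    moreover have "s \<ge> 0" unfolding s_def by (intro sum_nonneg) auto
    then have "\<bar>y\<bar> + s \<le> r \<longleftrightarrow> y \<in> {-r..r} \<and> s \<le> r - \<bar>y\<bar>"
      by auto
    ultimately show ?thesis
      by (simp add: indicator_def)
  qed
  have "emeasure (lborel_pow (Suc n)) (cross_polytope (Suc n) r) =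
      (\<integral>\<^sup>+ x. indicator (cross_polytope (Suc n) r) x \<partial>lborel_pow (Suc n))"
    by simp
  also have "\<dots> = (\<integral>\<^sup>+ y. \<integral>\<^sup>+ x. indicator (cross_polytope (Suc n) r) (x(n := y)) \<partial>lborel_pow n \<partial>lborel)"
    unfolding lessThan_Suc
    by (rule product_nn_integral_insert_rev) (auto simp flip: lessThan_Suc)
  also have "\<dots> = (\<integral>\<^sup>+ y. indicator {-r..r} y * emeasure (lborel_pow n) (cross_polytope n (r - \<bar>y\<bar>)) \<partial>lborel)"
  proof (rule nn_integral_cong)
    fix y
    have "(\<integral>\<^sup>+ x. indicator (cross_polytope (Suc n) r) (x(n := y)) \<partial>lborel_pow n) =
      (\<integral>\<^sup>+ x. indicator {-r..r} y * indicator (cross_polytope n (r - \<bar>y\<bar>)) x \<partial>lborel_pow n)"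
      by (rule nn_integral_cong) (rule *)
    also have "\<dots> = indicator {-r..r} y * emeasure (lborel_pow n) (cross_polytope n (r - \<bar>y\<bar>))"
      by (subst nn_integral_cmult) auto
    finally show "(\<integral>\<^sup>+ x. indicator (cross_polytope (Suc n) r) (x(n := y)) \<partial>lborel_pow n) =
      indicator {-r..r} y * emeasure (lborel_pow n) (cross_polytope n (r - \<bar>y\<bar>))" .
  qed
  also have "\<dots> = (\<integral>\<^sup>+ y. ennreal ((2 * (r - \<bar>y\<bar>)) ^ n) * indicator {-r..r} y * ennreal (1 / fact n) \<partial>lborel)"
    by (rule nn_integral_cong) (auto simp: Suc.IH indicator_def simp flip: ennreal_mult)
  also have "\<dots> = ennreal ((2 * r) ^ Suc n / real (Suc n)) * ennreal (1 / fact n)"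
    by (subst nn_integral_multc, measurable) (simp only: nn_integral_tent[OF Suc.prems])
  also have "\<dots> = ennreal ((2 * r) ^ Suc n / fact (Suc n))"
    using Suc.prems by (simp flip: ennreal_mult)
  finally show ?case .
qed

section \<open>Integral polynomials as a lattice, and Minkowski's packing argument\<close>

abbreviation real_of_int_poly :: "int poly \<Rightarrow> real poly" where
  "real_of_int_poly \<equiv> map_poly real_of_int"

lemma real_of_int_poly_add: "real_of_int_poly (p + q) = real_of_int_poly p + real_of_int_poly q"
  and real_of_int_poly_diff: "real_of_int_poly (p - q) = real_of_int_poly p - real_of_int_poly q"
  and real_of_int_poly_monom: "real_of_int_poly (Polynomial.monom c k) = Polynomial.monom (real_of_int c) k"
  and real_of_int_poly_mult: "real_of_int_poly (p * q) = real_of_int_poly p * real_of_int_poly q"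
  by (auto simp: poly_eq_iff coeff_map_poly coeff_mult)

definition newton_comb :: "(nat \<Rightarrow> real) \<Rightarrow> nat \<Rightarrow> (nat \<Rightarrow> real) \<Rightarrow> real poly" where
  "newton_comb x n d = (\<Sum>k<n. smult (d k) (newton x k))"

lemma newton_comb_diff:
  assumes "\<And>i. i < n \<Longrightarrow> c i = d i - e i"
  shows "newton_comb x n c = newton_comb x n d - newton_comb x n e"
  using assms by (simp add: newton_comb_def smult_diff_left sum_subtractf)

lemma coeff_newton_comb_above: "i \<ge> n \<Longrightarrow> poly.coeff (newton_comb x n d) i = 0"
  by (auto simp: newton_comb_def coeff_sum intro!: sum.neutral monic_deg_coeff_above[OF monic_deg_newton])

lemma poly_newton_comb:
  assumes "i < n"
  shows "poly (newton_comb x n d) (x i) = (\<Sum>k\<le>i. poly (newton x k) (x i) * d k)"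
proof -
  have "poly (newton_comb x n d) (x i) = (\<Sum>k<n. poly (newton x k) (x i) * d k)"
    by (simp add: newton_comb_def poly_sum mult.commute)
  also have "\<dots> = (\<Sum>k\<le>i. poly (newton x k) (x i) * d k)"
    by (rule sum.mono_neutral_right) (use assms in \<open>auto simp: poly_newton_eq_0\<close>)
  finally show ?thesis .
qed

text \<open>For distinct nodes, evaluation is triangular with nonzero diagonal, so forward
  substitution recovers the coordinates.\<close>

lemma newton_comb_inject:
  assumes "inj_on x {..<n}" "newton_comb x n d = newton_comb x n e" "k < n"
  shows "d k = e k"
  using \<open>k < n\<close>
proof (induction k rule: less_induct)
  case (less k)
  have "(\<Sum>l\<le>k. poly (newton x l) (x k) * d l) = (\<Sum>l\<le>k. poly (newton x l) (x k) * e l)"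
    using assms(2) poly_newton_comb[OF less.prems] by metis
  moreover have "(\<Sum>l<k. poly (newton x l) (x k) * d l) = (\<Sum>l<k. poly (newton x l) (x k) * e l)"
    using less by (intro sum.cong) auto
  ultimately have "poly (newton x k) (x k) * d k = poly (newton x k) (x k) * e k"
    by (simp add: lessThan_Suc_atMost[symmetric])
  moreover have "poly (newton x k) (x k) \<noteq> 0"
    using inj_onD[OF assms(1)] less.prems by (fastforce simp: poly_newton)
  ultimately show ?case by simp
qed

text \<open>Strip off the top coefficient: its floor goes to an integral monomial and its fractional
  part to the Newton coordinate. Since \<open>newton x n\<close> is monic, the rest has lower
  degree.\<close>

lemma int_poly_plus_unit_cube:
  fixes p :: "real poly"
  assumes "\<And>i. i \<ge> n \<Longrightarrow> poly.coeff p i = 0"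
  shows "\<exists>q e. (\<forall>k<n. e k \<in> {0..<1}) \<and> p = real_of_int_poly q + newton_comb x n e"
  using assms
proof (induction n arbitrary: p)
  case 0
  then have "p = 0" by (auto simp: poly_eq_iff)
  then show ?case by (intro exI[of _ 0]) (simp add: newton_comb_def)
next
  case (Suc n)
  define a where "a = poly.coeff p n"
  define p' where "p' = p - Polynomial.monom (real_of_int \<lfloor>a\<rfloor>) n - smult (frac a) (newton x n)"
  have "poly.coeff p' i = 0" if "i \<ge> n" for i
    using that Suc.prems[of i] monic_deg_newton[of n x] monic_deg_coeff_above[OF monic_deg_newton, of n i x]
    by (cases "i = n") (auto simp: p'_def a_def monic_deg_def frac_def)
  from Suc.IH[OF this] obtain q e where e: "\<And>k. k < n \<Longrightarrow> e k \<in> {0..<1}"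
    and p': "p' = real_of_int_poly q + newton_comb x n e" by blast
  have "p = real_of_int_poly (q + Polynomial.monom \<lfloor>a\<rfloor> n) + newton_comb x (Suc n) (e(n := frac a))"
    using p' unfolding p'_def real_of_int_poly_add real_of_int_poly_monom
    by (simp add: newton_comb_def algebra_simps)
  moreover have "(e(n := frac a)) k \<in> {0..<1}" if "k < Suc n" for k
    using e that by (auto simp: frac_lt_1 less_Suc_eq)
  ultimately show ?case by blast
qed

lemma countable_int_poly: "countable (UNIV :: int poly set)"
proof (rule countableI')
  show "inj (\<lambda>p :: int poly. to_nat (coeffs p))"
    by (auto simp: inj_on_def coeffs_eq_iff)
qed

text \<open>
  The integral polynomials of degree less than \<open>n\<close> form a lattice; in coordinates with respect
  to the Newton basis at the nodes, the half-open unit cube is a fundamental domain because the basis is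
  monic, and evaluation at the nodes is a triangular map.
\<close>

theorem minkowski_vandermonde:
  fixes x :: "nat \<Rightarrow> real"
  assumes inj: "inj_on x {..<n}" and "r \<ge> 0"
    and large: "\<And>q :: int poly. q \<noteq> 0 \<Longrightarrow> Polynomial.degree q < n \<Longrightarrow> 2 * r < (\<Sum>i<n. \<bar>poly (real_of_int_poly q) (x i)\<bar>)"
  shows "(2 * r) ^ n / fact n \<le> (\<Prod>j<n. \<Prod>i<j. \<bar>x j - x i\<bar>)"
proof -
  define M where "M = lborel_pow n"
  define T where "T = triangular_map (\<lambda>i k. poly (newton x k) (x i)) (\<lambda>_. 0) n"
  \<comment> \<open>In Newton coordinates, \<open>F\<close> is the fundamental cube,
    \<open>S\<close> the preimage of the cross-polytope under evaluation, and \<Lambda> the lattice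
    of integral polynomials.\<close>
  define F where "F = Pi\<^sub>E {..<n} (\<lambda>_. {0..<1 :: real})"
  define S where "S = {d \<in> space M. T d \<in> cross_polytope n r}"
  define \<Lambda> where "\<Lambda> = {d \<in> space M. \<exists>q. newton_comb x n d = real_of_int_poly q}"
  have [measurable]: "T \<in> M \<rightarrow>\<^sub>M M" unfolding T_def M_def by measurable
  have [measurable]: "cross_polytope n r \<in> sets M" unfolding M_def by measurable
  have [measurable]: "S \<in> sets M" unfolding S_def by measurable
  have [measurable]: "F \<in> sets M" unfolding F_def M_def by (intro sets_PiM_I_finite) auto
  have space_M: "space M = extensional {..<n}" by (simp add: M_def space_PiM PiE_def)
  have T: "T d i = poly (newton_comb x n d) (x i)" if "i < n" for d i
    using that by (simp add: T_def triangular_map_def poly_newton_comb)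
  have T_space: "T d \<in> space M" for d by (simp add: space_M T_def triangular_map_def)
  have S_iff: "d \<in> S \<longleftrightarrow> d \<in> space M \<and> (\<Sum>i<n. \<bar>poly (newton_comb x n d) (x i)\<bar>) \<le> r" for d
    using T_space[of d] by (simp add: S_def cross_polytope_def M_def T)
  have emeasure_F: "emeasure M F = 1"
  proof -
    interpret finite_product_sigma_finite "\<lambda>_. lborel :: real measure" "{..<n}" by standard auto
    show ?thesis unfolding M_def F_def by (subst measure_times) auto
  qed

  have "inj_on (\<lambda>d. SOME q. newton_comb x n d = real_of_int_poly q) \<Lambda>"
  proof (rule inj_onI)
    fix d e assume de: "d \<in> \<Lambda>" "e \<in> \<Lambda>"
      "(SOME q. newton_comb x n d = real_of_int_poly q) = (SOME q. newton_comb x n e = real_of_int_poly q)"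
    have "newton_comb x n d = real_of_int_poly (SOME q. newton_comb x n d = real_of_int_poly q)"
      using de(1) unfolding \<Lambda>_def by (auto intro: someI_ex)
    moreover have "newton_comb x n e = real_of_int_poly (SOME q. newton_comb x n e = real_of_int_poly q)"
      using de(2) unfolding \<Lambda>_def by (auto intro: someI_ex)
    ultimately have "newton_comb x n d = newton_comb x n e" using de(3) by simp
    then show "d = e"
      using newton_comb_inject[OF inj] de(1,2) by (auto simp: \<Lambda>_def space_M intro: extensionalityI)
  qed
  then have "countable \<Lambda>"
    using countable_int_poly countable_image_inj_on[of _ \<Lambda>] countable_subset subset_UNIV by metis

  \<comment> \<open>The index set \<open>N\<close> lets one enumeration serve for finite \<Lambda>
    as well, which occurs for \<open>n = 0\<close>.\<close>
  define N where "N = to_nat_on \<Lambda> ` \<Lambda>"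
  define l where "l i = from_nat_into \<Lambda> i" for i
  have l: "l i \<in> \<Lambda>" "to_nat_on \<Lambda> (l i) = i" if "i \<in> N" for i
    using that \<open>countable \<Lambda>\<close> by (auto simp: N_def l_def)
  \<comment> \<open>\<open>A i\<close> is the part of \<open>S\<close> in the translate of
    \<open>F\<close> by the lattice point \<open>l i\<close>; \<open>B i\<close> is that part moved
    back into \<open>F\<close>.\<close>
  define A where "A i = (if i \<in> N then {d \<in> S. (\<lambda>j\<in>{..<n}. - l i j + d j) \<in> F} else {})" for i
  define B where "B i = (if i \<in> N then {e \<in> F. (\<lambda>j\<in>{..<n}. l i j + e j) \<in> S} else {})" for i
  have tr [measurable]: "(\<lambda>d. \<lambda>j\<in>{..<n}. t j + d j) \<in> M \<rightarrow>\<^sub>M M" for t :: "nat \<Rightarrow> real"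
    unfolding M_def by measurable
  have pre: "{d \<in> V. (\<lambda>j\<in>{..<n}. t j + d j) \<in> W} \<in> sets M"
    if "V \<in> sets M" "W \<in> sets M" for V W and t :: "nat \<Rightarrow> real"
  proof -
    have "{d \<in> V. (\<lambda>j\<in>{..<n}. t j + d j) \<in> W} = V \<inter> ((\<lambda>d. \<lambda>j\<in>{..<n}. t j + d j) -` W \<inter> space M)"
      using sets.sets_into_space[OF that(1)] by auto
    then show ?thesis using measurable_sets[OF tr that(2)] that(1) by simp
  qed
  have A_sets: "A i \<in> sets M" for i
    unfolding A_def using pre[of S F "\<lambda>j. - l i j"] by simp
  have B_sets: "B i \<in> sets M" for i
    unfolding B_def by (auto intro: pre)
  have emeasure_AB: "emeasure M (A i) = emeasure M (B i)" for i
  proof (cases "i \<in> N")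
    case True
    have "{d \<in> space M. (\<lambda>j\<in>{..<n}. l i j + d j) \<in> A i} = B i"
    proof -
      have "(\<lambda>j\<in>{..<n}. - l i j + (\<lambda>j\<in>{..<n}. l i j + d j) j) = d" if "d \<in> space M" for d
        using that by (auto simp: space_M extensional_def)
      moreover have "F \<subseteq> space M" by (auto simp: F_def space_M PiE_def)
      ultimately show ?thesis using True by (auto simp: A_def B_def)
    qed
    then show ?thesis
      using emeasure_translate[of "A i" n "l i"] A_sets[of i] by (simp add: M_def)
  qed (simp add: A_def B_def)

  have "S \<subseteq> (\<Union>i. A i)"
  proof
    fix d assume d: "d \<in> S"
    obtain q e where e: "\<forall>k<n. e k \<in> {0..<1}" and q: "newton_comb x n d = real_of_int_poly q + newton_comb x n e"
      using int_poly_plus_unit_cube[of n "newton_comb x n d" x] coeff_newton_comb_above by metis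
    define \<mu> where "\<mu> = (\<lambda>j\<in>{..<n}. d j - e j)"
    have "newton_comb x n \<mu> = newton_comb x n d - newton_comb x n e"
      by (rule newton_comb_diff) (simp add: \<mu>_def)
    then have "\<mu> \<in> \<Lambda>" using q by (auto simp: \<Lambda>_def space_M \<mu>_def)
    then have "to_nat_on \<Lambda> \<mu> \<in> N" "l (to_nat_on \<Lambda> \<mu>) = \<mu>"
      using \<open>countable \<Lambda>\<close> by (auto simp: N_def l_def)
    moreover have "(\<lambda>j\<in>{..<n}. - \<mu> j + d j) \<in> F"
      using e by (auto simp: F_def \<mu>_def PiE_def)
    ultimately have "d \<in> A (to_nat_on \<Lambda> \<mu>)"
      using d by (simp add: A_def)
    then show "d \<in> (\<Union>i. A i)" by blast
  qed

  \<comment> \<open>A point common to two pieces comes from two points of \<open>S\<close> that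
    differ by a lattice vector. Its values at the nodes have absolute sum at most
    \<open>2 * r\<close>, so it is zero by \<open>large\<close>.\<close>
  have disj: "disjoint_family B"
    unfolding disjoint_family_on_def
  proof (intro ballI impI)
    fix i j :: nat assume "i \<noteq> j"
    show "B i \<inter> B j = {}"
    proof (rule ccontr)
      assume "B i \<inter> B j \<noteq> {}"
      then obtain e where e: "e \<in> B i" "e \<in> B j" by blast
      then have N: "i \<in> N" "j \<in> N" by (auto simp: B_def split: if_splits)
      define u v where uv: "u = (\<lambda>k\<in>{..<n}. l i k + e k)" "v = (\<lambda>k\<in>{..<n}. l j k + e k)"
      have "u \<in> S" "v \<in> S" using e N by (auto simp: B_def uv)
      obtain q where q: "newton_comb x n (l i) = real_of_int_poly q" using l[OF N(1)] by (auto simp: \<Lambda>_def)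
      obtain q' where q': "newton_comb x n (l j) = real_of_int_poly q'" using l[OF N(2)] by (auto simp: \<Lambda>_def)
      have "newton_comb x n (\<lambda>k. u k - v k) = newton_comb x n u - newton_comb x n v"
        by (rule newton_comb_diff) simp
      moreover have "newton_comb x n (\<lambda>k. u k - v k) = newton_comb x n (l i) - newton_comb x n (l j)"
        by (rule newton_comb_diff) (simp add: uv)
      ultimately have uvq: "newton_comb x n u - newton_comb x n v = real_of_int_poly (q - q')"
        by (simp add: q q' real_of_int_poly_diff)
      have "(\<Sum>i<n. \<bar>poly (real_of_int_poly (q - q')) (x i)\<bar>) \<le>
          (\<Sum>i<n. \<bar>poly (newton_comb x n u) (x i)\<bar> + \<bar>poly (newton_comb x n v) (x i)\<bar>)"
        unfolding uvq[symmetric] by (intro sum_mono) simp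
      also have "\<dots> \<le> 2 * r"
        using \<open>u \<in> S\<close> \<open>v \<in> S\<close> by (simp add: S_iff sum.distrib)
      finally have small: "(\<Sum>i<n. \<bar>poly (real_of_int_poly (q - q')) (x i)\<bar>) \<le> 2 * r" .
      have "q - q' = 0"
      proof (rule ccontr)
        assume nz: "q - q' \<noteq> 0"
        have "poly.coeff (real_of_int_poly (q - q')) k = 0" if "k \<ge> n" for k
          unfolding uvq[symmetric] using that by (simp add: coeff_newton_comb_above)
        then have "poly.coeff (q - q') k = 0" if "k \<ge> n" for k
          using that by (auto simp: coeff_map_poly)
        then have "Polynomial.degree (q - q') < n"
          using nz by (metis leading_coeff_0_iff not_le_imp_less)
        then show False using large[OF nz] small by linarith
      qed
      then have "newton_comb x n (l i) = newton_comb x n (l j)" using q q' by simp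
      then have "l i = l j"
        using newton_comb_inject[OF inj] l(1)[OF N(1)] l(1)[OF N(2)]
        by (auto simp: \<Lambda>_def space_M intro: extensionalityI)
      then show False using l(2)[OF N(1)] l(2)[OF N(2)] \<open>i \<noteq> j\<close> by simp
    qed
  qed

  \<comment> \<open>The pieces cover \<open>S\<close>, and moved back they are disjoint inside
    \<open>F\<close>, which has volume 1.\<close>
  have "emeasure M S \<le> emeasure M (\<Union>i. A i)"
    using \<open>S \<subseteq> (\<Union>i. A i)\<close> A_sets by (intro emeasure_mono) auto
  also have "\<dots> \<le> (\<Sum>i. emeasure M (A i))"
    using A_sets by (intro emeasure_subadditive_countably) auto
  also have "\<dots> = (\<Sum>i. emeasure M (B i))"
    by (simp add: emeasure_AB)
  also have "\<dots> = emeasure M (\<Union>i. B i)"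
    using B_sets disj by (intro suminf_emeasure) auto
  also have "\<dots> \<le> emeasure M F"
    by (intro emeasure_mono) (auto simp: B_def split: if_splits)
  finally have S_le: "emeasure M S \<le> 1" by (simp add: emeasure_F)

  have diag: "(\<Prod>i<n. \<bar>poly (newton x i) (x i)\<bar>) = (\<Prod>j<n. \<Prod>i<j. \<bar>x j - x i\<bar>)"
    by (simp add: poly_newton abs_prod)
  have "ennreal (\<Prod>i<n. \<bar>poly (newton x i) (x i)\<bar>) * emeasure M S = emeasure M (cross_polytope n r)"
    unfolding S_def T_def M_def
    by (rule emeasure_triangular_map) (simp, use inj_onD[OF inj] in \<open>fastforce simp: poly_newton\<close>)+
  then have "ennreal ((2 * r) ^ n / fact n) = ennreal (\<Prod>j<n. \<Prod>i<j. \<bar>x j - x i\<bar>) * emeasure M S"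
    unfolding diag using emeasure_cross_polytope[OF \<open>r \<ge> 0\<close>, of n] by (simp add: M_def)
  also have "\<dots> \<le> ennreal (\<Prod>j<n. \<Prod>i<j. \<bar>x j - x i\<bar>) * 1"
    by (intro mult_left_mono S_le) auto
  finally show ?thesis
    by (simp add: ennreal_le_iff prod_nonneg)
qed

section \<open>Integral products over the roots and the discriminant bound\<close>

text \<open>Pseudo-division multiplies the dividend by a power of the leading coefficient, which is
  1 here.\<close>

lemma monic_int_division:
  fixes F p :: "int poly"
  assumes "Polynomial.lead_coeff F = 1"
  obtains s r where "p = F * s + r" "r = 0 \<or> Polynomial.degree r < Polynomial.degree F"
proof -
  obtain s r where sr: "pseudo_divmod p F = (s, r)" by force
  have "F \<noteq> 0" using assms by auto
  from pseudo_divmod[OF this sr] show thesis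
    using that assms by simp
qed

lemma poly_eq_sum_lessThan:
  fixes p :: "'a::comm_semiring_1 poly"
  assumes "\<And>k. k \<ge> n \<Longrightarrow> poly.coeff p k = 0"
  shows "poly p x = (\<Sum>k<n. poly.coeff p k * x ^ k)"
proof -
  have "poly p x = (\<Sum>k\<le>Polynomial.degree p. poly.coeff p k * x ^ k)"
    by (rule poly_altdef)
  also have "\<dots> = (\<Sum>k\<in>{..<n} \<union> {..Polynomial.degree p}. poly.coeff p k * x ^ k)"
    by (rule sum.mono_neutral_left) (auto simp: coeff_eq_0)
  also have "\<dots> = (\<Sum>k<n. poly.coeff p k * x ^ k)"
    by (rule sum.mono_neutral_right) (use assms in auto)
  finally show ?thesis .
qed

text \<open>
  In terms of the Vandermonde matrix \<open>W\<close> of the roots, multiplication by \<open>q\<close> modulo \<open>F\<close>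
  has an integer matrix \<open>A\<close> with \<open>W D = A W\<close> for the diagonal matrix \<open>D\<close> of values of \<open>q\<close>.
\<close>

lemma prod_poly_at_roots_int:
  fixes F q :: "int poly" and x :: "nat \<Rightarrow> real"
  assumes "Polynomial.lead_coeff F = 1" "Polynomial.degree F = n"
    and inj: "inj_on x {..<n}" and roots: "\<And>i. i < n \<Longrightarrow> poly (real_of_int_poly F) (x i) = 0"
  shows "(\<Prod>i<n. poly (real_of_int_poly q) (x i)) \<in> \<int>"
proof -
  have "\<exists>r s. Polynomial.monom 1 j * q = F * s + r \<and> (r = 0 \<or> Polynomial.degree r < n)" for j
    using monic_int_division[OF assms(1), of "Polynomial.monom 1 j * q"] assms(2) by metis
  then obtain r s where rs: "\<And>j. Polynomial.monom 1 j * q = F * s j + r j"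
    and deg: "\<And>j. r j = 0 \<or> Polynomial.degree (r j) < n"
    by metis
  have coeff_r: "poly.coeff (real_of_int_poly (r j)) k = 0" if "k \<ge> n" for j k
    using deg[of j] that by (auto simp: coeff_map_poly coeff_eq_0)
  have val: "x i ^ j * poly (real_of_int_poly q) (x i) = (\<Sum>k<n. real_of_int (poly.coeff (r j) k) * x i ^ k)"
    if "i < n" for i j
  proof -
    have "x i ^ j * poly (real_of_int_poly q) (x i) = poly (real_of_int_poly (Polynomial.monom 1 j * q)) (x i)"
      by (simp add: real_of_int_poly_mult poly_monom real_of_int_poly_monom)
    also have "\<dots> = poly (real_of_int_poly (r j)) (x i)"
      unfolding rs using roots[OF that] by (simp add: real_of_int_poly_mult real_of_int_poly_add)
    also have "\<dots> = (\<Sum>k<n. real_of_int (poly.coeff (r j) k) * x i ^ k)"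
      by (subst poly_eq_sum_lessThan[OF coeff_r]) (auto simp: coeff_map_poly)
    finally show ?thesis .
  qed
  define W where "W = mat n n (\<lambda>(j, i). x i ^ j)"
  define E where "E = mat n n (\<lambda>(i, j). if i = j then poly (real_of_int_poly q) (x i) else 0)"
  define A where "A = mat n n (\<lambda>(j, k). poly.coeff (r j) k)"
  have [simp]: "W \<in> carrier_mat n n" "E \<in> carrier_mat n n" "map_mat real_of_int A \<in> carrier_mat n n"
    by (auto simp: W_def E_def A_def)
  have "W * E = map_mat real_of_int A * W"
  proof (rule eq_matI)
    fix j i assume "j < dim_row (map_mat real_of_int A * W)" "i < dim_col (map_mat real_of_int A * W)"
    then have ij: "j < n" "i < n" by (auto simp: A_def W_def)
    have "(W * E) $$ (j, i) = (\<Sum>k<n. x k ^ j * (if k = i then poly (real_of_int_poly q) (x k) else 0))"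
      using ij by (simp add: W_def E_def scalar_prod_def atLeast0LessThan)
    also have "\<dots> = (\<Sum>k<n. if k = i then x k ^ j * poly (real_of_int_poly q) (x k) else 0)"
      by (intro sum.cong) auto
    also have "\<dots> = x i ^ j * poly (real_of_int_poly q) (x i)"
      using ij by simp
    also have "\<dots> = (map_mat real_of_int A * W) $$ (j, i)"
      using ij by (simp add: val[OF ij(2)] W_def A_def scalar_prod_def atLeast0LessThan)
    finally show "(W * E) $$ (j, i) = (map_mat real_of_int A * W) $$ (j, i)" .
  qed (auto simp: W_def E_def A_def)
  then have "det W * det E = det (map_mat real_of_int A) * det W"
    by (metis det_mult \<open>W \<in> carrier_mat n n\<close> \<open>E \<in> carrier_mat n n\<close> \<open>map_mat real_of_int A \<in> carrier_mat n n\<close>)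
  \<comment> \<open>The nodes are distinct, so this determinant can be cancelled; it leaves the
    integer \<open>det A\<close>.\<close>
  moreover have "det W \<noteq> 0"
  proof -
    have "det W = (\<Prod>j<n. \<Prod>i<j. x j - x i)"
      using det_monic_deg[of n "\<lambda>k. Polynomial.monom 1 k" x]
      by (simp add: monic_deg_def degree_monom_le poly_monom W_def)
    then show ?thesis
      using inj_onD[OF inj] by fastforce
  qed
  ultimately have "det E = real_of_int (det A)" by simp
  moreover have "det E = prod_list (diag_mat E)"
    by (rule det_lower_triangular[where n = n]) (auto simp: E_def)
  moreover have "prod_list (diag_mat E) = (\<Prod>i<n. poly (real_of_int_poly q) (x i))"
    unfolding diag_mat_def
    by (subst prod.distinct_set_conv_list[symmetric]) (auto simp: E_def atLeast0LessThan)
  ultimately show ?thesis by simp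
qed

text \<open>The arithmetic-geometric mean inequality, obtained by summing ln y \<le> y - 1.\<close>

lemma card_le_sum_abs:
  fixes y :: "nat \<Rightarrow> real"
  assumes "1 \<le> \<bar>\<Prod>i<n. y i\<bar>"
  shows "real n \<le> (\<Sum>i<n. \<bar>y i\<bar>)"
proof -
  have nz: "y i \<noteq> 0" if "i < n" for i
  proof
    assume "y i = 0"
    then have "(\<Prod>i<n. y i) = 0" using that by (intro prod_zero) auto
    then show False using assms by (metis abs_zero not_one_le_zero)
  qed
  have "0 \<le> ln (\<Prod>i<n. \<bar>y i\<bar>)"
    using assms by (simp add: abs_prod)
  also have "\<dots> = (\<Sum>i<n. ln \<bar>y i\<bar>)"
    by (rule ln_prod) (use nz in auto)
  also have "\<dots> \<le> (\<Sum>i<n. \<bar>y i\<bar> - 1)"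
    by (intro sum_mono ln_le_minus_one) (use nz in auto)
  finally show ?thesis by (simp add: sum_subtractf)
qed

theorem b_seq_le_vandermonde_sq:
  fixes F :: "int poly" and x :: "nat \<Rightarrow> real"
  assumes F: "Polynomial.lead_coeff F = 1" "Polynomial.degree F = n" and "n \<ge> 1"
    and inj: "inj_on x {..<n}" and roots: "\<And>i. i < n \<Longrightarrow> poly (real_of_int_poly F) (x i) = 0"
    and irred: "\<And>(q :: int poly) i. q \<noteq> 0 \<Longrightarrow> Polynomial.degree q < n \<Longrightarrow> i < n \<Longrightarrow> poly (real_of_int_poly q) (x i) \<noteq> 0"
  shows "b_seq n \<le> (\<Prod>j<n. \<Prod>i<j. x j - x i)\<^sup>2"
proof -
  define V where "V = (\<Prod>j<n. \<Prod>i<j. \<bar>x j - x i\<bar>)"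
  have sum_ge: "real n \<le> (\<Sum>i<n. \<bar>poly (real_of_int_poly q) (x i)\<bar>)"
    if "q \<noteq> 0" "Polynomial.degree q < n" for q :: "int poly"
  proof (rule card_le_sum_abs)
    obtain z where z: "(\<Prod>i<n. poly (real_of_int_poly q) (x i)) = real_of_int z"
      using prod_poly_at_roots_int[OF F inj roots, of q] by (auto elim: Ints_cases)
    moreover have "(\<Prod>i<n. poly (real_of_int_poly q) (x i)) \<noteq> 0"
      using irred[OF that] by (auto simp: prod_zero_iff)
    ultimately show "1 \<le> \<bar>\<Prod>i<n. poly (real_of_int_poly q) (x i)\<bar>"
      by simp
  qed
  \<comment> \<open>The packing theorem asks for a strict inequality, so the radius is
    \<open>t / 2\<close> with \<open>t < n\<close>; then \<open>t\<close> tends to \<open>n\<close>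
    from the left.\<close>
  have bound: "t ^ n / fact n \<le> V" if "0 \<le> t" "t < real n" for t
  proof -
    have "(2 * (t / 2)) ^ n / fact n \<le> V"
      unfolding V_def
      by (rule minkowski_vandermonde[OF inj]) (use that sum_ge in fastforce)+
    then show ?thesis by simp
  qed
  have "((\<lambda>t. t ^ n / fact n) \<longlongrightarrow> real n ^ n / fact n) (at_left (real n))"
    by (intro tendsto_intros) simp
  moreover have "eventually (\<lambda>t. t ^ n / fact n \<le> V) (at_left (real n))"
    using \<open>n \<ge> 1\<close> by (intro eventually_mono[OF eventually_at_left_real[of 0 "real n"]] bound) auto
  ultimately have "real n ^ n / fact n \<le> V"
    by (rule tendsto_upperbound) simp
  then have "(real n ^ n / fact n)\<^sup>2 \<le> V\<^sup>2"
    by (intro power_mono) auto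
  also have "V\<^sup>2 = (\<Prod>j<n. \<Prod>i<j. x j - x i)\<^sup>2"
    by (simp add: V_def flip: abs_prod)
  finally show ?thesis
    by (simp add: b_seq_def power_divide power_even_eq power_mult mult.commute)
qed

section \<open>Minimal polynomials\<close>

abbreviation of_rat_poly :: "rat poly \<Rightarrow> 'a::field_char_0 poly" where
  "of_rat_poly \<equiv> map_poly of_rat"

lemma of_rat_poly_mult: "of_rat_poly (p * q) = of_rat_poly p * of_rat_poly q"
  and of_rat_poly_add: "of_rat_poly (p + q) = of_rat_poly p + of_rat_poly q"
  and of_rat_poly_pderiv: "of_rat_poly (pderiv p) = pderiv (of_rat_poly p)"
  by (auto simp: poly_eq_iff coeff_map_poly coeff_mult of_rat_mult of_rat_add of_rat_sum coeff_pderiv)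

lemma of_rat_poly_of_int: "of_rat_poly (map_poly of_int q) = map_poly of_int q"
  by (auto simp: poly_eq_iff coeff_map_poly)

lemma degree_of_rat_poly: "Polynomial.degree (of_rat_poly p) = Polynomial.degree p"
  by (rule degree_map_poly) auto

lemma field_complex_field: "field complex_field"
  by (rule field_from_type_algebra)

lemma domain_complex_field: "domain complex_field"
  using field_complex_field by (rule field.axioms)

lemma ring_complex_field: "ring complex_field"
  by (rule ring_from_type_algebra)

lemma monoid_complex_field: "monoid complex_field"
  using ring_complex_field by (rule ring.axioms)

lemma complex_field_simps [simp]:
  "carrier complex_field = UNIV" "x \<otimes>\<^bsub>complex_field\<^esub> y = x * y" "x \<oplus>\<^bsub>complex_field\<^esub> y = x + y"
  "\<zero>\<^bsub>complex_field\<^esub> = 0" "\<one>\<^bsub>complex_field\<^esub> = 1"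
  by (auto simp: ring_of_type_algebra_def)

lemma complex_field_pow [simp]: "x [^]\<^bsub>complex_field\<^esub> (n :: nat) = x ^ n"
  by (induction n) (auto simp: monoid.nat_pow_Suc[OF monoid_complex_field] monoid.nat_pow_0[OF monoid_complex_field])

lemma complex_field_a_inv [simp]: "\<ominus>\<^bsub>complex_field\<^esub> x = - x"
  using abelian_group.minus_equality[OF ring.is_abelian_group[OF ring_complex_field], of "- x" x] by simp

lemma complex_field_m_inv [simp]: "x \<noteq> 0 \<Longrightarrow> inv\<^bsub>complex_field\<^esub> x = inverse x"
  by (rule comm_monoid.comm_inv_char[OF cring.axioms(2)[OF domain.axioms(1)[OF domain_complex_field]]]) auto

text \<open>The reversal is due to \<open>ring.eval\<close> reading the leading coefficient first
  and \<open>Poly\<close> the constant one.\<close>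

lemma complex_field_eval: "ring.eval complex_field p x = poly (Poly (rev p)) x"
  by (induction p) (auto simp: ring.eval.simps[OF ring_complex_field] Poly_snoc poly_monom)

lemma subfield_Rats: "subfield \<rat> complex_field"
proof (rule field.subfieldI'[OF field_complex_field])
  show "subring \<rat> complex_field"
    by (rule ring.subringI[OF ring_complex_field]) auto
qed auto

lemma rats_list_conv:
  assumes "p \<in> carrier (\<rat> [X]\<^bsub>complex_field\<^esub>)"
  shows "\<exists>q :: rat poly. Poly (rev p) = of_rat_poly q"
proof -
  have "set p \<subseteq> \<rat>"
    using assms by (auto simp: univ_poly_def polynomial_def)
  then have "\<forall>y\<in>set (rev p). \<exists>r. y = of_rat r" by (auto simp: Rats_def)
  then obtain rs where "rev p = map of_rat rs"
    using ex_map_conv[of "rev p" of_rat] by auto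
  then have "Poly (rev p) = of_rat_poly (Poly rs)"
    by (simp add: poly_eq_iff coeff_map_poly coeff_Poly_eq nth_default_map_eq[of _ 0])
  then show ?thesis by blast
qed

lemma rat_poly_to_list:
  fixes q :: "rat poly"
  assumes "q \<noteq> 0"
  defines "p \<equiv> rev (coeffs (of_rat_poly q :: complex poly))"
  shows "p \<in> carrier (\<rat> [X]\<^bsub>complex_field\<^esub>)" "p \<noteq> []" "length p - 1 = Polynomial.degree q" "Poly (rev p) = of_rat_poly q"
proof -
  have nz: "of_rat_poly q \<noteq> (0 :: complex poly)"
    using assms by (auto simp: poly_eq_iff coeff_map_poly)
  then show "p \<noteq> []" "Poly (rev p) = of_rat_poly q" by (auto simp: p_def)
  show "length p - 1 = Polynomial.degree q"
    using nz by (simp add: p_def length_coeffs_degree degree_of_rat_poly)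
  have "set p \<subseteq> \<rat>"
    by (auto simp: p_def coeffs_def coeff_map_poly)
  moreover have "hd p \<noteq> 0"
    using nz by (simp add: p_def hd_rev last_coeffs_eq_coeff_degree)
  ultimately show "p \<in> carrier (\<rat> [X]\<^bsub>complex_field\<^esub>)"
    by (auto simp: univ_poly_def polynomial_def)
qed

lemma algebraic_over_Rats:
  assumes "algebraic_int \<theta>"
  shows "(ring.algebraic complex_field over \<rat>) \<theta>"
proof -
  obtain q :: "int poly" where q: "poly (map_poly of_int q) \<theta> = 0" "Polynomial.lead_coeff q = 1"
    using assms by (auto simp: algebraic_int_altdef_ipoly)
  define r :: "rat poly" where "r = map_poly of_int q"
  have "poly.coeff r (Polynomial.degree q) = 1"
    using q(2) by (simp add: r_def coeff_map_poly)
  then have "r \<noteq> 0" by auto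
  from rat_poly_to_list[OF this] show ?thesis
    using q(1)
    by (intro ring.algebraicI[OF ring_complex_field, of "rev (coeffs (of_rat_poly r))"])
      (auto simp: complex_field_eval r_def of_rat_poly_of_int)
qed

text \<open>The bridge out of the algebraic library: later arguments use only the polynomial
  \<open>m\<close> obtained here and its minimality.\<close>

theorem rat_minpoly_rat_poly:
  assumes "algebraic_int \<theta>"
  obtains m :: "rat poly" where "Polynomial.lead_coeff m = 1" "Polynomial.degree m = rat_adjoin_degree \<theta>"
    "\<And>z. ring.eval complex_field (rat_minpoly \<theta>) z = poly (of_rat_poly m) z"
    "poly (of_rat_poly m) \<theta> = 0"
    "\<And>q :: rat poly. q \<noteq> 0 \<Longrightarrow> poly (of_rat_poly q) \<theta> = 0 \<Longrightarrow> Polynomial.degree m \<le> Polynomial.degree q"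
proof -
  define p where "p = rat_minpoly \<theta>"
  note alg = algebraic_over_Rats[OF assms]
  have \<theta>: "\<theta> \<in> carrier complex_field" by simp
  note Irr = domain.IrrE[OF domain_complex_field subfield_Rats \<theta> alg, folded rat_minpoly_def, folded p_def]
  obtain m :: "rat poly" where m: "Poly (rev p) = of_rat_poly m"
    using rats_list_conv[OF Irr(1)] by blast
  have "p \<noteq> []" using domain.pirreducibleE(1)[OF domain_complex_field _ Irr(1,2)] subfieldE(1)[OF subfield_Rats] by auto
  then have "coeffs (Poly (rev p)) = rev p"
    using Irr(3) \<open>p \<noteq> []\<close> by (cases p) (auto simp: coeffs_Poly)
  then have cm: "coeffs (of_rat_poly m :: complex poly) = rev p" by (simp add: m)
  have deg: "Polynomial.degree m = length p - 1"
    using cm by (metis degree_of_rat_poly degree_eq_length_coeffs length_rev)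
  have "of_rat_poly m \<noteq> (0 :: complex poly)"
    using cm \<open>p \<noteq> []\<close> by auto
  then have "Polynomial.lead_coeff (of_rat_poly m :: complex poly) = 1"
    using cm Irr(3) \<open>p \<noteq> []\<close> by (metis last_coeffs_eq_coeff_degree last_rev complex_field_simps(5))
  then have "Polynomial.lead_coeff m = 1"
    by (simp add: degree_of_rat_poly coeff_map_poly)
  moreover have "Polynomial.degree m = rat_adjoin_degree \<theta>"
  proof -
    have sub: "subring \<rat> complex_field" using subfieldE(1)[OF subfield_Rats] .
    \<comment> \<open>As \<theta> is algebraic, the ring generated by it is already a field and
      equals the generated field; its dimension is known from the degree of the minimal
      polynomial.\<close>
    have "ring.simple_extension complex_field \<rat> \<theta> = generate_field complex_field (insert \<theta> \<rat>)"
    proof (rule field.generate_fieldI[OF field_complex_field])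
      show "subfield (ring.simple_extension complex_field \<rat> \<theta>) complex_field"
        using domain.simple_extension_is_subfield[OF domain_complex_field subfield_Rats \<theta>] alg by simp
      show "insert \<theta> \<rat> \<subseteq> ring.simple_extension complex_field \<rat> \<theta>"
        using ring.simple_extension_mem[OF ring_complex_field sub \<theta>] ring.simple_extension_incl[OF ring_complex_field, of \<rat> \<theta>] by auto
      fix K assume "subfield K complex_field" "insert \<theta> \<rat> \<subseteq> K"
      then show "ring.simple_extension complex_field \<rat> \<theta> \<subseteq> K"
        using ring.simple_extension_subring_incl[OF ring_complex_field, of K \<rat> \<theta>] subfieldE(1) by auto
    qed auto
    then show ?thesis
      using domain.simple_extension_dim[OF domain_complex_field subfield_Rats \<theta> alg]
      by (simp add: deg p_def rat_minpoly_def rat_adjoin_degree_def rat_adjoin_def over_def)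
  qed
  moreover have "ring.eval complex_field (rat_minpoly \<theta>) z = poly (of_rat_poly m) z" for z
    by (simp add: complex_field_eval m flip: p_def)
  moreover from this have "poly (of_rat_poly m) \<theta> = 0"
    using Irr(4) by (simp flip: p_def)
  moreover have "Polynomial.degree m \<le> Polynomial.degree q"
    if "q \<noteq> 0" "poly (of_rat_poly q) \<theta> = 0" for q :: "rat poly"
  proof -
    note l = rat_poly_to_list[OF that(1)]
    have ev: "ring.eval complex_field (rev (coeffs (of_rat_poly q))) \<theta> = \<zero>\<^bsub>complex_field\<^esub>"
      using that(2) by (simp add: complex_field_eval)
    from domain.pdivides_imp_degree_le[OF domain_complex_field subfieldE(1)[OF subfield_Rats] Irr(1) l(1,2)]
      domain.Irr_minimal[OF domain_complex_field subfield_Rats \<theta> alg l(1) ev, folded rat_minpoly_def, folded p_def]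
    have "length p - 1 \<le> length (rev (coeffs (of_rat_poly q :: complex poly))) - 1" by blast
    then
    show ?thesis using l(3) by (simp add: deg)
  qed
  ultimately show thesis using that by blast
qed

section \<open>Integrality of the minimal polynomial by Gauss's lemma\<close>

lemma clear_denominators:
  fixes p :: "rat poly"
  shows "\<exists>d q. d \<noteq> 0 \<and> smult (of_int d) p = map_poly of_int q"
proof (induction p)
  case 0
  show ?case by (intro exI[of _ 1] exI[of _ 0]) simp
next
  case (pCons a p)
  then obtain d q where dq: "d \<noteq> 0" "smult (of_int d) p = map_poly of_int q" by blast
  obtain k l where kl: "quotient_of a = (k, l)" by force
  have l: "l > 0" "a = of_int k / of_int l"
    using quotient_of_denom_pos[OF kl] quotient_of_div[OF kl] by auto
  have "smult (of_int (l * d)) (pCons a p) = pCons (of_int (k * d)) (smult (of_int l) (smult (of_int d) p))"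
    using l by simp
  also have "\<dots> = map_poly of_int (pCons (k * d) (smult l q))"
    unfolding dq(2) by (simp add: map_poly_pCons) (simp add: poly_eq_iff coeff_map_poly)
  finally show ?case
    using l(1) dq(1) by (intro exI[of _ "l * d"] exI[of _ "pCons (k * d) (smult l q)"]) simp
qed

lemma map_poly_of_int_inject: "map_poly of_int p = (map_poly of_int q :: rat poly) \<longleftrightarrow> p = q"
  by (auto simp: poly_eq_iff coeff_map_poly)

lemma content_monic: "Polynomial.lead_coeff G = 1 \<Longrightarrow> Polynomial.content G = 1" for G :: "int poly"
  using content_dvd_coeff[of G "Polynomial.degree G"] normalize_content[of G]
  by (metis is_unit_normalize)

text \<open>Gauss's lemma. After clearing denominators, multiplicativity of contents shows that the
  primitive parts multiply to \<open>G\<close> up to sign. Their leading coefficients are therefore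
  units, and \<open>m\<close> is a primitive part up to sign.\<close>

lemma monic_factor_of_monic_int_poly:
  fixes m h :: "rat poly" and G :: "int poly"
  assumes "Polynomial.lead_coeff m = 1" "Polynomial.lead_coeff G = 1" "map_poly of_int G = m * h"
  obtains F :: "int poly" where "m = map_poly of_int F" "Polynomial.lead_coeff F = 1"
proof -
  obtain a A where A: "a \<noteq> 0" "smult (of_int a) m = map_poly of_int A"
    using clear_denominators by blast
  obtain b B where B: "b \<noteq> 0" "smult (of_int b) h = map_poly of_int B"
    using clear_denominators by blast
  have mult: "map_poly of_int (p * q) = (map_poly of_int p * map_poly of_int q :: rat poly)" for p q
    by (auto simp: poly_eq_iff coeff_map_poly coeff_mult)
  have smult: "map_poly of_int (smult c p) = (smult (of_int c) (map_poly of_int p) :: rat poly)" for c p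
    by (auto simp: poly_eq_iff coeff_map_poly)
  have "map_poly of_int (A * B) = (map_poly of_int (smult (a * b) G) :: rat poly)"
    unfolding mult smult A(2)[symmetric] B(2)[symmetric] assms(3) by (simp add: mult.commute)
  then have AB: "A * B = smult (a * b) G"
    by (simp only: map_poly_of_int_inject)
  define A' B' where "A' = primitive_part A" "B' = primitive_part B"
  have A': "A = smult (Polynomial.content A) A'" and B': "B = smult (Polynomial.content B) B'"
    by (simp_all add: A'_B'_def)
  \<comment> \<open>The multipliers \<open>a\<close> and \<open>b\<close> are only known to be
    nonzero, whereas contents are nonnegative; hence the two signs from here on.\<close>
  have "Polynomial.content A * Polynomial.content B = \<bar>a * b\<bar>"
    using arg_cong[OF AB, of Polynomial.content] content_monic[OF assms(2)] by (simp add: content_mult abs_mult)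
  then have cab: "Polynomial.content A * Polynomial.content B = a * b \<or> Polynomial.content A * Polynomial.content B = - (a * b)" by linarith
  have "smult (Polynomial.content A * Polynomial.content B) (A' * B') = smult (a * b) G"
    using AB A' B' by (metis mult_smult_left mult_smult_right smult_smult mult.commute)
  then have "smult (a * b) (A' * B') = smult (a * b) G \<or> smult (a * b) (- (A' * B')) = smult (a * b) G"
    using cab by (auto simp: smult_minus_left)
  moreover have "p = q" if "smult (a * b) p = smult (a * b) q" for p q :: "int poly"
  proof -
    have "smult (a * b) (p - q) = 0" using that by (simp add: smult_diff_right)
    then show ?thesis using A(1) B(1) by simp
  qed
  ultimately have "A' * B' = G \<or> - (A' * B') = G" by blast
  then have "A' * B' = G \<or> A' * B' = - G" by auto
  then have "Polynomial.lead_coeff A' * Polynomial.lead_coeff B' = 1 \<or> Polynomial.lead_coeff A' * Polynomial.lead_coeff B' = - 1"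
    using assms(2) by (auto simp flip: lead_coeff_mult)
  then have unit: "Polynomial.lead_coeff A' = 1 \<or> Polynomial.lead_coeff A' = - 1"
    by (metis zmult_eq_1_iff zmult_eq_neg1_iff)
  have "a = Polynomial.lead_coeff A"
    using arg_cong[OF A(2), of Polynomial.lead_coeff] assms(1) A(1) by (simp add: degree_map_poly coeff_map_poly)
  also have "\<dots> = Polynomial.content A * Polynomial.lead_coeff A'"
    using A' by (metis lead_coeff_smult)
  finally have a: "a = Polynomial.content A * Polynomial.lead_coeff A'" .
  \<comment> \<open>Multiplying by the leading coefficient, which is 1 or -1, makes the primitive
    part monic.\<close>
  define F where "F = smult (Polynomial.lead_coeff A') A'"
  have ll: "Polynomial.lead_coeff A' * Polynomial.lead_coeff A' = 1" using unit by auto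
  have "smult a F = A"
    unfolding F_def by (subst A', subst a) (simp add: ll mult.assoc)
  then have "smult (of_int a) m = smult (of_int a) (map_poly of_int F)"
    unfolding A(2) by (simp flip: smult)
  then have "smult (of_int a) (m - map_poly of_int F) = 0"
    by (simp add: smult_diff_right)
  then have "m = map_poly of_int F" using A(1) by simp
  moreover have "Polynomial.lead_coeff F = 1" using unit by (auto simp: F_def)
  ultimately show thesis using that by blast
qed

text \<open>By minimality, \<open>m\<close> divides a monic integral polynomial that vanishes at
  \<theta>, since the remainder also vanishes there; Gauss's lemma then applies.\<close>

theorem minimal_rat_poly_is_int:
  fixes m :: "rat poly" and \<theta> :: complex
  assumes "algebraic_int \<theta>" "Polynomial.lead_coeff m = 1" "poly (of_rat_poly m) \<theta> = 0"
    and min: "\<And>q :: rat poly. q \<noteq> 0 \<Longrightarrow> poly (of_rat_poly q) \<theta> = 0 \<Longrightarrow> Polynomial.degree m \<le> Polynomial.degree q"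
  obtains F :: "int poly" where "m = map_poly of_int F" "Polynomial.lead_coeff F = 1"
proof -
  obtain G :: "int poly" where G: "poly (map_poly of_int G) \<theta> = 0" "Polynomial.lead_coeff G = 1"
    using assms by (auto simp: algebraic_int_altdef_ipoly)
  define g :: "rat poly" where "g = map_poly of_int G"
  have m0: "m \<noteq> 0" using assms(2) by auto
  have "g = m * (g div m) + g mod m" by simp
  then have "of_rat_poly g = (of_rat_poly m * of_rat_poly (g div m) + of_rat_poly (g mod m) :: complex poly)"
    by (metis of_rat_poly_mult of_rat_poly_add)
  then have "poly (of_rat_poly (g mod m)) \<theta> = 0"
    using G(1) assms(3) by (simp add: g_def of_rat_poly_of_int)
  then have "g mod m = 0"
    using min[of "g mod m"] degree_mod_less[OF m0, of g] by force
  then have "map_poly of_int G = m * (g div m)"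
    by (metis g_def mod_0_imp_dvd dvd_mult_div_cancel)
  from monic_factor_of_monic_int_poly[OF assms(2) G(2) this] show thesis using that by blast
qed

text \<open>A polynomial of least degree vanishing at a conjugate divides \<open>m\<close>, and one of the two factors
  vanishes at \<open>\<theta>\<close>; so the minimality of \<open>m\<close> carries over to every conjugate.\<close>

lemma minimal_degree_conjugate:
  fixes m q :: "rat poly" and \<theta> z :: complex
  assumes m: "m \<noteq> 0" "poly (of_rat_poly m) \<theta> = 0"
    and min: "\<And>q :: rat poly. q \<noteq> 0 \<Longrightarrow> poly (of_rat_poly q) \<theta> = 0 \<Longrightarrow> Polynomial.degree m \<le> Polynomial.degree q"
    and z: "poly (of_rat_poly m) z = 0" and q: "q \<noteq> 0" "poly (of_rat_poly q) z = 0"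
  shows "Polynomial.degree m \<le> Polynomial.degree q"
proof -
  define P where "P p \<longleftrightarrow> p \<noteq> 0 \<and> poly (of_rat_poly p) z = 0" for p :: "rat poly"
  define p where "p = arg_min Polynomial.degree P"
  have "P q" using q by (simp add: P_def)
  then have "P p" and p_min: "\<And>r. P r \<Longrightarrow> Polynomial.degree p \<le> Polynomial.degree r"
    unfolding p_def by (auto intro: arg_min_natI arg_min_nat_le)
  then have p: "p \<noteq> 0" "poly (of_rat_poly p) z = 0" by (auto simp: P_def)
  define k where "k = m div p"
  have mk: "m = p * k + m mod p" by (simp add: k_def)
  then have "of_rat_poly m = (of_rat_poly p * of_rat_poly k + of_rat_poly (m mod p) :: complex poly)"
    by (metis of_rat_poly_mult of_rat_poly_add)
  then have "poly (of_rat_poly (m mod p)) z = 0"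
    using z p(2) by simp
  then have "m mod p = 0"
    using p_min[of "m mod p"] degree_mod_less[OF p(1), of m] by (force simp: P_def)
  then have "m = p * k" using mk by simp
  then have "k \<noteq> 0" and deg: "Polynomial.degree m = Polynomial.degree p + Polynomial.degree k"
    using m(1) p(1) by (auto simp: degree_mult_eq)
  have "poly (of_rat_poly p) \<theta> = 0 \<or> poly (of_rat_poly k) \<theta> = 0"
    using m(2) \<open>m = p * k\<close> by (simp add: of_rat_poly_mult)
  then have "Polynomial.degree m \<le> Polynomial.degree p"
  proof
    \<comment> \<open>Minimality would leave \<open>p\<close> constant, but a nonzero constant does
      not vanish at \<open>z\<close>.\<close>
    assume "poly (of_rat_poly k) \<theta> = 0"
    then have "Polynomial.degree p = 0" using min[OF \<open>k \<noteq> 0\<close>] deg by simp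
    then obtain c where "p = [:c:]" by (rule degree_eq_zeroE)
    then show ?thesis using p by (auto simp: map_poly_pCons split: if_splits)
  qed (rule min[OF p(1)])
  then show ?thesis using p_min[OF \<open>P q\<close>] by simp
qed

text \<open>A multiple root would also be a root of the derivative, whose smaller degree contradicts
  minimality at that conjugate. So the roots are simple and their number is the degree.\<close>

lemma card_roots_minimal:
  fixes m :: "rat poly" and \<theta> :: complex
  assumes m: "m \<noteq> 0" "poly (of_rat_poly m) \<theta> = 0"
    and min: "\<And>q :: rat poly. q \<noteq> 0 \<Longrightarrow> poly (of_rat_poly q) \<theta> = 0 \<Longrightarrow> Polynomial.degree m \<le> Polynomial.degree q"
  shows "card {z :: complex. poly (of_rat_poly m) z = 0} = Polynomial.degree m"
proof -
  define M :: "complex poly" where "M = of_rat_poly m"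
  have "Polynomial.degree m > 0"
  proof (rule ccontr)
    assume "\<not> Polynomial.degree m > 0"
    then obtain c where "m = [:c:]" using degree_eq_zeroE[of m] by auto
    then show False using m by (auto simp: map_poly_pCons split: if_splits)
  qed
  then have pd: "pderiv m \<noteq> 0" "Polynomial.degree (pderiv m) < Polynomial.degree m"
    by (auto simp: pderiv_eq_0_iff degree_pderiv)
  have "rsquarefree M"
    unfolding rsquarefree_roots
  proof (intro allI notI)
    fix z assume z: "poly M z = 0 \<and> poly (pderiv M) z = 0"
    have "Polynomial.degree m \<le> Polynomial.degree (pderiv m)"
      by (rule minimal_degree_conjugate[OF m min, of z]) (use z pd in \<open>auto simp: M_def of_rat_poly_pderiv\<close>)
    then show False using pd by simp
  qed
  then have dec: "smult (Polynomial.lead_coeff M) (\<Prod>z|poly M z = 0. [:-z, 1:]) = M"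
    by (rule complex_poly_decompose_rsquarefree)
  have "M \<noteq> 0" using m(1) by (auto simp: M_def poly_eq_iff coeff_map_poly)
  then have "Polynomial.degree M = Polynomial.degree (\<Prod>z|poly M z = 0. [:-z, 1:])"
    using dec by (metis degree_smult_eq leading_coeff_0_iff)
  also have "\<dots> = card {z. poly M z = 0}"
    by (subst degree_prod_eq_sum_degree) auto
  finally show ?thesis by (simp add: M_def degree_of_rat_poly)
qed

section \<open>Combination of the two discriminant bounds\<close>

lemma poly_of_int_of_real:
  "poly (map_poly of_int q) (complex_of_real t) = complex_of_real (poly (real_of_int_poly q) t)"
  by (induction q) (auto simp: map_poly_pCons)

theorem theorem3p3:
  fixes \<alpha> \<beta> :: real and n0 :: nat and \<theta> :: complex
  assumes "0 < \<beta> - \<alpha>" and "\<beta> - \<alpha> < 4"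
    and "n0 \<ge> 2"
    and "a_seq \<alpha> \<beta> n0 < b_seq n0"
    and "a_seq \<alpha> \<beta> (n0 + 1) / a_seq \<alpha> \<beta> n0 < b_seq (n0 + 1) / b_seq n0"
    and "algebraic_int \<theta>"
    and "\<And>z. ring.eval complex_field (rat_minpoly \<theta>) z = 0 \<Longrightarrow> z \<in> complex_of_real ` {\<alpha>..\<beta>}"
  shows "rat_adjoin_degree \<theta> < n0"
proof (rule ccontr)
  define n where "n = rat_adjoin_degree \<theta>"
  assume "\<not> rat_adjoin_degree \<theta> < n0"
  then have "n \<ge> n0" by (simp add: n_def)
  then have "n \<ge> 2" using assms(3) by simp
  obtain m :: "rat poly" where m: "Polynomial.lead_coeff m = 1" "Polynomial.degree m = n"
    and eval: "\<And>z. ring.eval complex_field (rat_minpoly \<theta>) z = poly (of_rat_poly m) z"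
    and root: "poly (of_rat_poly m) \<theta> = 0"
    and min: "\<And>q :: rat poly. q \<noteq> 0 \<Longrightarrow> poly (of_rat_poly q) \<theta> = 0 \<Longrightarrow> Polynomial.degree m \<le> Polynomial.degree q"
    using rat_minpoly_rat_poly[OF assms(6)] unfolding n_def by metis
  have "m \<noteq> 0" using m(1) by auto
  obtain F :: "int poly" where F: "m = map_poly of_int F" "Polynomial.lead_coeff F = 1"
    using minimal_rat_poly_is_int[OF assms(6) m(1) root min] by blast
  have "Polynomial.degree F = n"
    using m(2) by (simp add: F(1) degree_map_poly)
  define R where "R = {z :: complex. poly (of_rat_poly m) z = 0}"
  have "card R = n"
    using card_roots_minimal[OF \<open>m \<noteq> 0\<close> root min] m(2) by (simp add: R_def)
  moreover from this have "finite R" using \<open>n \<ge> 2\<close> by (intro card_ge_0_finite) simp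
  ultimately obtain e where e: "bij_betw e {..<n} R"
    using ex_bij_betw_nat_finite[of R] by (auto simp: atLeast0LessThan)
  \<comment> \<open>The roots are real by hypothesis, so taking real parts loses nothing and the
    points stay distinct.\<close>
  define x where "x i = Re (e i)" for i
  have e_R: "e i \<in> R" if "i < n" for i
    using bij_betwE[OF e] that by auto
  have e_x: "e i = complex_of_real (x i)" and x_mem: "x i \<in> {\<alpha>..\<beta>}" if "i < n" for i
    using assms(7)[of "e i"] e_R[OF that] by (auto simp: R_def eval x_def)
  have inj: "inj_on x {..<n}"
    using bij_betw_imp_inj_on[OF e] e_x by (auto simp: inj_on_def)
  have x_root: "poly (of_rat_poly m) (complex_of_real (x i)) = 0" if "i < n" for i
    using e_R[OF that] e_x[OF that] by (simp add: R_def)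
  have roots: "poly (real_of_int_poly F) (x i) = 0" if "i < n" for i
    using x_root[OF that] by (simp add: F(1) of_rat_poly_of_int poly_of_int_of_real)
  \<comment> \<open>Minimality carried over from \<theta> to the conjugates; it makes the integral
    products in the lower bound nonzero.\<close>
  have nonroot: "poly (real_of_int_poly q) (x i) \<noteq> 0"
    if "q \<noteq> 0" "Polynomial.degree q < n" "i < n" for q :: "int poly" and i
  proof
    assume "poly (real_of_int_poly q) (x i) = 0"
    then have "poly (of_rat_poly (map_poly of_int q)) (complex_of_real (x i)) = 0"
      by (simp add: of_rat_poly_of_int poly_of_int_of_real)
    moreover have "map_poly of_int q \<noteq> (0 :: rat poly)"
      using that(1) map_poly_of_int_inject[of q 0] by simp
    ultimately have "Polynomial.degree m \<le> Polynomial.degree (map_poly of_int q :: rat poly)"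
      using minimal_degree_conjugate[OF \<open>m \<noteq> 0\<close> root min x_root[OF that(3)]] by blast
    then show False using that(2) m(2) by (simp add: degree_map_poly)
  qed
  \<comment> \<open>The discriminant is squeezed between \<open>b_seq n\<close> and
    \<open>a_seq \<alpha> \<beta> n\<close>, which are in the wrong order for
    \<open>n \<ge> n0\<close>.\<close>
  have "b_seq n \<le> (\<Prod>j<n. \<Prod>i<j. x j - x i)\<^sup>2"
    by (rule b_seq_le_vandermonde_sq[OF F(2) \<open>Polynomial.degree F = n\<close> _ inj roots nonroot])
      (use \<open>n \<ge> 2\<close> in auto)
  also have "\<dots> \<le> a_seq \<alpha> \<beta> n"
    by (rule vandermonde_sq_le_a_seq[OF x_mem \<open>n \<ge> 2\<close>]) (use assms(1) in auto)
  also have "\<dots> < b_seq n"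
    by (rule a_seq_less_b_seq[OF assms(1,3,4,5) \<open>n \<ge> n0\<close>])
  finally show False by simp
qed

end
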